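(* Let $k\ge 0$, let $B_0\in\mathbb{R}^{n\times n}$ be symmetric, let $(s_0,y_0),\dots,(s_k,y_k)$ be pairs of vectors in $\mathbb{R}^n$ and let $\phi_0,\dots,\phi_k\in\mathbb{R}$ (arbitrary real parameters, allowed to be negative and to vary with the index). Let $B_1,\dots,B_{k+1}$ be the matrices generated from $B_0$ by the Broyden class updates $$B_{j+1}=B_j-\frac{1}{s_j^TB_js_j}B_js_js_j^TB_j+\frac{1}{y_j^Ts_j}y_jy_j^T+\phi_j(s_j^TB_js_j)w_jw_j^T,\qquad w_j=\frac{y_j}{y_j^Ts_j}-\frac{B_js_j}{s_j^TB_js_j},\qquad 0\le j\le k,$$ where $y_j^Ts_j\neq0$ and $s_j^TB_js_j\ne 0$ for $0\le j\le k$, and $B_0,\dots,B_{k+1}$ are nonsingular. With $\Psi_k=(B_0S_k\ \ Y_k)\in\mathbb{R}^{n\times 2(k+1)}$ and with $S_k,Y_k,L_k,D_k,\Pi_k,\Xi_k,\Gamma_k$ as defined in the context, one has $$B_{k+1}=B_0+\widehat{\Psi}_k\widehat{M}_k\widehat{\Psi}_k^T,$$ where $\widehat{\Psi}_k=\Psi_k\Pi_k^T\Xi_k$ and $$\widehat{M}_k=\left(\Xi_k^T\Pi_k\begin{pmatrix}-S_k^TB_0S_k+\Gamma_k & -L_k+\Gamma_k\\ -L_k^T+\Gamma_k & D_k+\Gamma_k\end{pmatrix}\Pi_k^T\Xi_k\right)^{-1}$$ (the inverse exists).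
   Context: $I_j$ denotes the $j\times j$ identity matrix. $S_k=(s_0\ s_1\ \cdots\ s_k)$ and $Y_k=(y_0\ y_1\ \cdots\ y_k)$, both in $\mathbb{R}^{n\times(k+1)}$. Write $S_k^TY_k=L_k+D_k+R_k$ with $L_k$ strictly lower triangular, $D_k$ diagonal, $R_k$ strictly upper triangular. For each $j$, $\phi_j^{\mathrm{SR1}}=\dfrac{y_j^Ts_j}{y_j^Ts_j-s_j^TB_js_j}$; if $y_j^Ts_j=s_j^TB_js_j$ this value is undefined and $\phi_j\ne\phi_j^{\mathrm{SR1}}$ is regarded as holding. $\Pi_k\in\mathbb{R}^{2(k+1)\times2(k+1)}$ is the permutation matrix $$\Pi_k=\begin{pmatrix} I_k&0&0&0\\0&0&I_k&0\\0&1&0&0\\0&0&0&1\end{pmatrix}\quad(k\ge1),\qquad \Pi_0=I_2,$$ with column blocks of sizes $k,1,k,1$ and row blocks of sizes $k,k,1,1$. $\Xi_k$ is defined recursively by $\Xi_0=E_0$ and $$\Xi_k=\begin{pmatrix}\Pi_{k-1}^T\Xi_{k-1}&0\\0&E_k\end{pmatrix}\quad(k\ge1),\qquad E_j=\begin{cases}(-1\ \ 1)^T\in\mathbb{R}^{2\times1}&\text{if }\phi_j=\phi_j^{\mathrm{SR1}},\\ I_2&\text{otherwise.}\end{cases}$$ $\Gamma_k=\mathrm{diag}(\gamma_0,\dots,\gamma_k)\in\mathbb{R}^{(k+1)\times(k+1)}$ with $$\gamma_j=\begin{cases}\phi_j\left(-\dfrac{1-\phi_j}{s_j^TB_js_j}-\dfrac{\phi_j}{s_j^Ty_j}\right)^{-1}&\text{if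 }\phi_j\neq\phi_j^{\mathrm{SR1}},\\ 0&\text{otherwise.}\end{cases}$$ *)

theory Defs
  imports "Jordan_Normal_Form.Gauss_Jordan_Elimination"
begin

definition outer_prod :: "real vec \<Rightarrow> real vec \<Rightarrow> real mat" where
  "outer_prod u v = mat (dim_vec u) (dim_vec v) (\<lambda>(i, j). u $ i * v $ j)"

definition broyden_w :: "real mat \<Rightarrow> real vec \<Rightarrow> real vec \<Rightarrow> real vec" where
  "broyden_w B s y =
     (1 / (y \<bullet> s)) \<cdot>\<^sub>v y - (1 / (s \<bullet> (B *\<^sub>v s))) \<cdot>\<^sub>v (B *\<^sub>v s)"

definition broyden_update :: "real mat \<Rightarrow> real vec \<Rightarrow> real vec \<Rightarrow> real \<Rightarrow> real mat" where
  "broyden_update B s y \<phi> =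
     B - (1 / (s \<bullet> (B *\<^sub>v s))) \<cdot>\<^sub>m (B * outer_prod s s * B)
       + (1 / (y \<bullet> s)) \<cdot>\<^sub>m outer_prod y y
       + (\<phi> * (s \<bullet> (B *\<^sub>v s))) \<cdot>\<^sub>m outer_prod (broyden_w B s y) (broyden_w B s y)"

definition phi_SR1 :: "real mat \<Rightarrow> real vec \<Rightarrow> real vec \<Rightarrow> real" where
  "phi_SR1 B s y = (y \<bullet> s) / (y \<bullet> s - s \<bullet> (B *\<^sub>v s))"

text \<open>If the denominator of \<^const>\<open>phi_SR1\<close> vanishes, the SR1 value is undefined and no
  parameter counts as equal to it; without the first conjunct, division by zero would make
  \<open>\<phi> = 0\<close> an SR1 step there.\<close>

definition is_SR1 :: "real mat \<Rightarrow> real vec \<Rightarrow> real vec \<Rightarrow> real \<Rightarrow> bool" where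
  "is_SR1 B s y \<phi> \<longleftrightarrow> y \<bullet> s \<noteq> s \<bullet> (B *\<^sub>v s) \<and> \<phi> = phi_SR1 B s y"

definition vecs_mat :: "nat \<Rightarrow> (nat \<Rightarrow> real vec) \<Rightarrow> nat \<Rightarrow> real mat" where
  "vecs_mat n v k = mat_of_cols n (map v [0..<Suc k])"

definition strict_lower_part :: "real mat \<Rightarrow> real mat" where
  "strict_lower_part A =
     mat (dim_row A) (dim_col A) (\<lambda>(i, j). if j < i then A $$ (i, j) else 0)"

definition diag_part :: "real mat \<Rightarrow> real mat" where
  "diag_part A = mat (dim_row A) (dim_col A) (\<lambda>(i, j). if i = j then A $$ (i, j) else 0)"

definition strict_upper_part :: "real mat \<Rightarrow> real mat" where
  "strict_upper_part A =
     mat (dim_row A) (dim_col A) (\<lambda>(i, j). if i < j then A $$ (i, j) else 0)"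

lemma triangular_splitting:
  "strict_lower_part A + diag_part A + strict_upper_part A = A"
  by (rule eq_matI) (auto simp: strict_lower_part_def diag_part_def strict_upper_part_def)

definition hcat :: "real mat \<Rightarrow> real mat \<Rightarrow> real mat" where
  "hcat A B = four_block_mat A B (0\<^sub>m 0 (dim_col A)) (0\<^sub>m 0 (dim_col B))"

definition Psi_mat :: "nat \<Rightarrow> real mat \<Rightarrow> (nat \<Rightarrow> real vec) \<Rightarrow> (nat \<Rightarrow> real vec) \<Rightarrow> nat \<Rightarrow> real mat"
  where "Psi_mat n B0 s y k = hcat (B0 * vecs_mat n s k) (vecs_mat n y k)"

definition Pi_mat :: "nat \<Rightarrow> real mat" where
  "Pi_mat k =
     (if k = 0 then 1\<^sub>m 2
      else four_block_mat
        (four_block_mat (1\<^sub>m k)   (0\<^sub>m k 1)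
                        (0\<^sub>m k k) (0\<^sub>m k 1))
        (four_block_mat (0\<^sub>m k k) (0\<^sub>m k 1)
                        (1\<^sub>m k)   (0\<^sub>m k 1))
        (four_block_mat (0\<^sub>m 1 k) (1\<^sub>m 1)
                        (0\<^sub>m 1 k) (0\<^sub>m 1 1))
        (four_block_mat (0\<^sub>m 1 k) (0\<^sub>m 1 1)
                        (0\<^sub>m 1 k) (1\<^sub>m 1)))"

definition E_mat ::
  "(nat \<Rightarrow> real mat) \<Rightarrow> (nat \<Rightarrow> real vec) \<Rightarrow> (nat \<Rightarrow> real vec) \<Rightarrow> (nat \<Rightarrow> real) \<Rightarrow> nat \<Rightarrow> real mat"
  where "E_mat B s y \<phi> j =
     (if is_SR1 (B j) (s j) (y j) (\<phi> j) then mat_of_cols_list 2 [[- 1, 1]] else 1\<^sub>m 2)"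

fun Xi_mat ::
  "(nat \<Rightarrow> real mat) \<Rightarrow> (nat \<Rightarrow> real vec) \<Rightarrow> (nat \<Rightarrow> real vec) \<Rightarrow> (nat \<Rightarrow> real) \<Rightarrow> nat \<Rightarrow> real mat"
  where
  "Xi_mat B s y \<phi> 0 = E_mat B s y \<phi> 0"
| "Xi_mat B s y \<phi> (Suc k) =
     (let X = (Pi_mat k)\<^sup>T * Xi_mat B s y \<phi> k; E = E_mat B s y \<phi> (Suc k)
      in four_block_mat X (0\<^sub>m (dim_row X) (dim_col E)) (0\<^sub>m (dim_row E) (dim_col X)) E)"

definition gamma_coeff :: "real mat \<Rightarrow> real vec \<Rightarrow> real vec \<Rightarrow> real \<Rightarrow> real" where
  "gamma_coeff B s y \<phi> =
     (if is_SR1 B s y \<phi> then 0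
      else \<phi> * inverse (- ((1 - \<phi>) / (s \<bullet> (B *\<^sub>v s))) - \<phi> / (s \<bullet> y)))"

definition Gamma_mat ::
  "(nat \<Rightarrow> real mat) \<Rightarrow> (nat \<Rightarrow> real vec) \<Rightarrow> (nat \<Rightarrow> real vec) \<Rightarrow> (nat \<Rightarrow> real) \<Rightarrow> nat \<Rightarrow> real mat"
  where "Gamma_mat B s y \<phi> k =
     mat_diag (Suc k) (\<lambda>j. gamma_coeff (B j) (s j) (y j) (\<phi> j))"

definition Psi_hat ::
  "nat \<Rightarrow> (nat \<Rightarrow> real mat) \<Rightarrow> (nat \<Rightarrow> real vec) \<Rightarrow> (nat \<Rightarrow> real vec) \<Rightarrow> (nat \<Rightarrow> real) \<Rightarrow> nat \<Rightarrow> real mat"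
  where "Psi_hat n B s y \<phi> k =
     Psi_mat n (B 0) s y k * (Pi_mat k)\<^sup>T * Xi_mat B s y \<phi> k"

definition M_hat_inv ::
  "nat \<Rightarrow> (nat \<Rightarrow> real mat) \<Rightarrow> (nat \<Rightarrow> real vec) \<Rightarrow> (nat \<Rightarrow> real vec) \<Rightarrow> (nat \<Rightarrow> real) \<Rightarrow> nat \<Rightarrow> real mat"
  where "M_hat_inv n B s y \<phi> k =
     (let S = vecs_mat n s k; Y = vecs_mat n y k;
          L = strict_lower_part (S\<^sup>T * Y); D = diag_part (S\<^sup>T * Y);
          G = Gamma_mat B s y \<phi> k;
          P = Pi_mat k; X = Xi_mat B s y \<phi> k
      in X\<^sup>T * P
           * four_block_mat (- (S\<^sup>T * B 0 * S) + G) (- L + G)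
                            (- (L\<^sup>T) + G)          (D + G)
           * P\<^sup>T * X)"

definition M_hat ::
  "nat \<Rightarrow> (nat \<Rightarrow> real mat) \<Rightarrow> (nat \<Rightarrow> real vec) \<Rightarrow> (nat \<Rightarrow> real vec) \<Rightarrow> (nat \<Rightarrow> real) \<Rightarrow> nat \<Rightarrow> real mat"
  where "M_hat n B s y \<phi> k = the (mat_inverse (M_hat_inv n B s y \<phi> k))"

end

theory Submission
  imports Defs "Jordan_Normal_Form.Determinant"
begin

text \<open>
A single Broyden update is a correction of rank at most two, written in the columns
\<open>W = (B s  y)\<close>: with \<open>\<sigma> = s\<^sup>T B s\<close> and \<open>\<eta> = y\<^sup>T s\<close> it has the form \<open>B + W Q W\<^sup>T\<close> for a symmetric
\<open>2 \<times> 2\<close> matrix \<open>Q\<close> of determinant \<open>- ((1 - \<phi>) \<eta> + \<phi> \<sigma>) / (\<sigma> \<eta>\<^sup>2)\<close>. That determinant vanishes exactly for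
the SR1 parameter. Away from it, \<open>Q\<inverse> = diag (-\<sigma>, \<eta>) + \<gamma> J\<close> where \<open>J\<close> is the all-ones matrix; this is what
the formula for \<open>\<gamma>\<close> expresses. At the SR1 parameter \<open>Q\<close> is \<open>1 / (\<eta> - \<sigma>)\<close> times
\<open>(-1 1)\<^sup>T (-1 1)\<close>. In both cases the update is \<open>B + (W E) C (W E)\<^sup>T\<close> with
\<open>C\<inverse> = E\<^sup>T (diag (-\<sigma>, \<eta>) + \<gamma> J) E\<close> (lemma \<open>compact_rep_single_update\<close>).

Successive corrections are composed by induction. Suppose \<open>B = B\<^sub>0 + P M P\<^sup>T\<close> with \<open>M\<inverse> = N\<close>. The next
correction involves \<open>B s = B\<^sub>0 s + P (M P\<^sup>T s)\<close>, so its columns are \<open>U + P V\<close>, where \<open>U = (B\<^sub>0 s  y) E\<close>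
refers only to the initial matrix. Stacking gives a representation by the columns \<open>(P  U + P V)\<close> with the
inverse middle matrix \<open>diag (N, D)\<close>; the columns \<open>(P  U)\<close> differ from these by a unipotent block matrix,
so passing to them is a congruence, and the inverse middle matrix becomes
\<open>(N, - N V; - V\<^sup>T N, D + V\<^sup>T N V)\<close> (lemma \<open>compact_rep_compose\<close>). For the \<open>V\<close> at hand,
\<open>N V = P\<^sup>T (s  0) E\<close> no longer mentions \<open>M\<close>, and adding \<open>V\<^sup>T N V\<close> to \<open>D\<close> merely turns
\<open>s\<^sup>T B s\<close> into \<open>s\<^sup>T B\<^sub>0 s\<close> (lemma \<open>compact_rep_broyden_step\<close>). Thus the later
iterates enter the inverse middle matrix only through the numbers \<open>\<gamma>\<^sub>j\<close> and the choice of the \<open>E\<^sub>j\<close>.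

It remains to see that the closed form obeys the same recursion. The permutation \<open>\<Pi>\<close> moves the newest pair
\<open>B\<^sub>0 s\<^sub>k, y\<^sub>k\<close> to the end, so that the large matrix is the one for the older pairs bordered by two
rows and columns (lemma \<open>core_mat_Suc_Pi\<close>). In the border, the column of \<open>y\<^sub>k\<close> vanishes above the corner
because only the strictly lower part \<open>L\<close> of \<open>S\<^sup>T Y\<close> enters, while that of \<open>B\<^sub>0 s\<^sub>k\<close>
consists of the inner products of \<open>s\<^sub>k\<close> with the older columns, up to sign. Once the factors \<open>\<Xi>\<close>
are applied, this border is the block \<open>- N V = - P\<^sup>T (s  0) E\<close> found above.
\<close>

section \<open>Compact representations and their composition\<close>

text \<open>Stated through dimensions rather than carriers, these two laws are rewrite rules whose side conditions
simplification can discharge.\<close>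

lemma mult_assoc_dim:
  fixes A B C :: "'a :: semiring_0 mat"
  assumes "dim_col A = dim_row B" "dim_col B = dim_row C"
  shows "A * B * C = A * (B * C)"
  using assms by (intro assoc_mult_mat[of _ "dim_row A" "dim_row B" _ "dim_row C" _ "dim_col C"]) auto

lemma transpose_mult_dim:
  fixes A B :: "'a :: comm_semiring_0 mat"
  assumes "dim_col A = dim_row B"
  shows "(A * B)\<^sup>T = B\<^sup>T * A\<^sup>T"
  using assms by (intro transpose_mult[of _ "dim_row A" "dim_row B" _ "dim_col B"]) auto

text \<open>\<open>A'\<close> arises from \<open>A\<close> by a symmetric correction in the columns of \<open>P\<close>. The middle matrix is recorded through its
inverse \<open>N\<close>, since it is the inverse that has a simple block structure when corrections are composed.\<close>

definition compact_rep :: "nat \<Rightarrow> nat \<Rightarrow> real mat \<Rightarrow> real mat \<Rightarrow> real mat \<Rightarrow> real mat \<Rightarrow> bool" where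
  "compact_rep n m A P N A' \<longleftrightarrow>
     A \<in> carrier_mat n n \<and> P \<in> carrier_mat n m \<and> N \<in> carrier_mat m m \<and>
     (\<exists>M \<in> carrier_mat m m. M\<^sup>T = M \<and> M * N = 1\<^sub>m m \<and> N * M = 1\<^sub>m m \<and> A' = A + P * M * P\<^sup>T)"

text \<open>The factor \<open>T\<close> moves from the columns into the middle matrix: \<open>M\<close> becomes \<open>T M T\<^sup>T\<close>, and its inverse
is obtained from \<open>N\<close> by the congruence with \<open>R = T\<inverse>\<close>.\<close>

lemma compact_rep_congruence:
  assumes rep: "compact_rep n m A (P * T) N A'"
    and P: "P \<in> carrier_mat n m" and T: "T \<in> carrier_mat m m" and R: "R \<in> carrier_mat m m"
    and RT: "R * T = 1\<^sub>m m" and TR: "T * R = 1\<^sub>m m"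
  shows "compact_rep n m A P (R\<^sup>T * N * R) A'"
proof -
  from rep obtain M where A: "A \<in> carrier_mat n n" and N: "N \<in> carrier_mat m m"
    and M: "M \<in> carrier_mat m m" and sym: "M\<^sup>T = M" and MN: "M * N = 1\<^sub>m m" and NM: "N * M = 1\<^sub>m m"
    and A': "A' = A + P * T * M * (P * T)\<^sup>T"
    unfolding compact_rep_def by auto
  note dims = carrier_matD[OF P] carrier_matD[OF T] carrier_matD[OF R] carrier_matD[OF N]
    carrier_matD[OF M]
  have TR': "T\<^sup>T * R\<^sup>T = 1\<^sub>m m" and RT': "R\<^sup>T * T\<^sup>T = 1\<^sub>m m"
    by (metis RT TR transpose_mult[OF R T] transpose_mult[OF T R] transpose_one)+
  have "T * M * T\<^sup>T * (R\<^sup>T * N * R) = T * (M * ((T\<^sup>T * R\<^sup>T) * (N * R)))"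
    by (simp add: mult_assoc_dim dims)
  also have "\<dots> = T * ((M * N) * R)"
    unfolding TR' using N R M by (simp add: mult_assoc_dim dims)
  also have "\<dots> = 1\<^sub>m m" using MN R TR by simp
  finally have 1: "T * M * T\<^sup>T * (R\<^sup>T * N * R) = 1\<^sub>m m" .
  have "R\<^sup>T * N * R * (T * M * T\<^sup>T) = R\<^sup>T * (N * ((R * T) * (M * T\<^sup>T)))"
    by (simp add: mult_assoc_dim dims)
  also have "\<dots> = R\<^sup>T * ((N * M) * T\<^sup>T)"
    unfolding RT using N T M by (simp add: mult_assoc_dim dims)
  also have "\<dots> = 1\<^sub>m m" using NM T RT' by simp
  finally have 2: "R\<^sup>T * N * R * (T * M * T\<^sup>T) = 1\<^sub>m m" .
  have 3: "(T * M * T\<^sup>T)\<^sup>T = T * M * T\<^sup>T"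
    by (simp add: transpose_mult_dim mult_assoc_dim dims sym)
  have 4: "A' = A + P * (T * M * T\<^sup>T) * P\<^sup>T"
    unfolding A' by (simp add: transpose_mult_dim mult_assoc_dim dims)
  have 5: "T * M * T\<^sup>T \<in> carrier_mat m m" using T M by auto
  show ?thesis unfolding compact_rep_def
    using 1 2 3 4 5 A P R N by (intro conjI bexI[of _ "T * M * T\<^sup>T"]) auto
qed

lemma hcat_carrier [simp]:
  "P \<in> carrier_mat n m \<Longrightarrow> U \<in> carrier_mat n r \<Longrightarrow> hcat P U \<in> carrier_mat n (m + r)"
  unfolding hcat_def by auto

lemma hcat_dims [simp]:
  "dim_row (hcat P U) = dim_row P" "dim_col (hcat P U) = dim_col P + dim_col U"
  unfolding hcat_def by auto

lemma hcat_index: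
  assumes "i < dim_row P" "j < dim_col P + dim_col U" "dim_row U = dim_row P"
  shows "hcat P U $$ (i, j) = (if j < dim_col P then P $$ (i, j) else U $$ (i, j - dim_col P))"
  using assms unfolding hcat_def by auto

lemma hcat_mult_four_block:
  assumes "P \<in> carrier_mat n m" "U \<in> carrier_mat n r"
    "A \<in> carrier_mat m p" "B \<in> carrier_mat m q" "C \<in> carrier_mat r p" "D \<in> carrier_mat r q"
  shows "hcat P U * four_block_mat A B C D = hcat (P * A + U * C) (P * B + U * D)"
proof -
  have "hcat P U * four_block_mat A B C D
      = four_block_mat (P * A + U * C) (P * B + U * D)
          (0\<^sub>m 0 m * A + 0\<^sub>m 0 r * C) (0\<^sub>m 0 m * B + 0\<^sub>m 0 r * D)"
    unfolding hcat_def using assms by (subst mult_four_block_mat[of _ n m _ r _ 0]) auto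
  also have "\<dots> = hcat (P * A + U * C) (P * B + U * D)"
    unfolding hcat_def using assms by simp
  finally show ?thesis .
qed

lemma hcat_mult_hcat_transpose:
  assumes "P \<in> carrier_mat n m" "U \<in> carrier_mat n r" "Q \<in> carrier_mat n m" "V \<in> carrier_mat n r"
  shows "hcat P U * (hcat Q V)\<^sup>T = P * Q\<^sup>T + U * V\<^sup>T"
proof (rule eq_matI)
  fix i j assume ij: "i < dim_row (P * Q\<^sup>T + U * V\<^sup>T)" "j < dim_col (P * Q\<^sup>T + U * V\<^sup>T)"
  then have i: "i < n" and j: "j < n" using assms by auto
  have r1: "row (hcat P U) i = row P i @\<^sub>v row U i"
    unfolding hcat_def using assms i by (intro row_four_block_mat(1)[of _ n m _ r _ 0]) auto
  have r2: "row (hcat Q V) j = row Q j @\<^sub>v row V j"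
    unfolding hcat_def using assms j by (intro row_four_block_mat(1)[of _ n m _ r _ 0]) auto
  have "row (hcat P U) i \<bullet> row (hcat Q V) j = row P i \<bullet> row Q j + row U i \<bullet> row V j"
    unfolding r1 r2 using assms i j by (intro scalar_prod_append[of _ m _ r]) auto
  then show "(hcat P U * (hcat Q V)\<^sup>T) $$ (i, j) = (P * Q\<^sup>T + U * V\<^sup>T) $$ (i, j)"
    using assms i j by auto
qed (use assms in \<open>auto simp: hcat_def\<close>)

lemma compact_rep_stack:
  assumes rep1: "compact_rep n m A P N A'" and rep2: "compact_rep n r A' W D A''"
  shows "compact_rep n (m + r) A (hcat P W) (four_block_mat N (0\<^sub>m m r) (0\<^sub>m r m) D) A''"
proof -
  from rep1 obtain M where A: "A \<in> carrier_mat n n" and P: "P \<in> carrier_mat n m"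
    and N: "N \<in> carrier_mat m m"
    and M: "M \<in> carrier_mat m m" "M\<^sup>T = M" "M * N = 1\<^sub>m m" "N * M = 1\<^sub>m m" "A' = A + P * M * P\<^sup>T"
    unfolding compact_rep_def by auto
  from rep2 obtain C where W: "W \<in> carrier_mat n r" and D: "D \<in> carrier_mat r r"
    and C: "C \<in> carrier_mat r r" "C\<^sup>T = C" "C * D = 1\<^sub>m r" "D * C = 1\<^sub>m r" "A'' = A' + W * C * W\<^sup>T"
    unfolding compact_rep_def by auto
  let ?K = "four_block_mat M (0\<^sub>m m r) (0\<^sub>m r m) C"
  let ?D = "four_block_mat N (0\<^sub>m m r) (0\<^sub>m r m) D"
  have 1: "?K\<^sup>T = ?K"
    using M C by (subst transpose_four_block_mat) auto
  have 2: "?K * ?D = 1\<^sub>m (m + r)" "?D * ?K = 1\<^sub>m (m + r)"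
    using M C N D by (subst mult_four_block_mat, auto)+
  have "hcat P W * ?K = hcat (P * M) (W * C)"
    using P W M C by (subst hcat_mult_four_block) auto
  then have "hcat P W * ?K * (hcat P W)\<^sup>T = P * M * P\<^sup>T + W * C * W\<^sup>T"
    using P W M C by (simp add: hcat_mult_hcat_transpose[of _ n m _ r])
  then have 3: "A'' = A + hcat P W * ?K * (hcat P W)\<^sup>T"
    using M C A P W by (simp add: assoc_add_mat[of _ n n])
  show ?thesis unfolding compact_rep_def
    using 1 2 3 A P W M C N D by (intro conjI bexI[of _ ?K]) auto
qed

text \<open>The columns \<open>U\<close> of the second correction are given relative to \<open>P\<close>. Eliminating the part \<open>P V\<close> from the stacked
columns by a unipotent \<open>T\<close> is a congruence, whose inverse \<open>R\<close> just negates \<open>V\<close>.\<close>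

lemma compact_rep_compose:
  assumes rep1: "compact_rep n m A P N A'" and rep2: "compact_rep n r A' (U + P * V) D A''"
    and U: "U \<in> carrier_mat n r" and V: "V \<in> carrier_mat m r"
  shows "compact_rep n (m + r) A (hcat P U)
           (four_block_mat N (- (N * V)) (- (V\<^sup>T * N)) (V\<^sup>T * (N * V) + D)) A''"
proof -
  from rep1 have P: "P \<in> carrier_mat n m" and N: "N \<in> carrier_mat m m"
    unfolding compact_rep_def by auto
  from rep2 have D: "D \<in> carrier_mat r r"
    unfolding compact_rep_def by auto
  let ?T = "four_block_mat (1\<^sub>m m) V (0\<^sub>m r m) (1\<^sub>m r)"
  let ?R = "four_block_mat (1\<^sub>m m) (- V) (0\<^sub>m r m) (1\<^sub>m r)"
  let ?B = "four_block_mat N (0\<^sub>m m r) (0\<^sub>m r m) D"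
  have "hcat P U * ?T = hcat P (U + P * V)"
    using P U V by (subst hcat_mult_four_block) (auto simp: comm_add_mat[of _ n r])
  then have rep: "compact_rep n (m + r) A (hcat P U * ?T) ?B A''"
    using compact_rep_stack[OF rep1 rep2] by simp
  have V0: "V + - V = 0\<^sub>m m r" "- V + V = 0\<^sub>m m r" "- 0\<^sub>m r r = (0\<^sub>m r r :: real mat)"
    using V by (auto intro!: eq_matI)
  have RT: "?R * ?T = 1\<^sub>m (m + r)" "?T * ?R = 1\<^sub>m (m + r)"
    using V V0 by (subst mult_four_block_mat, auto)+
  have tR: "?R\<^sup>T = four_block_mat (1\<^sub>m m) (0\<^sub>m m r) (- V\<^sup>T) (1\<^sub>m r)"
    using V by (subst transpose_four_block_mat) (auto simp: transpose_uminus)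
  have "?R\<^sup>T * ?B = four_block_mat N (0\<^sub>m m r) (- (V\<^sup>T * N)) D"
    unfolding tR using V N D by (subst mult_four_block_mat) auto
  then have eq: "?R\<^sup>T * ?B * ?R = four_block_mat N (- (N * V)) (- (V\<^sup>T * N)) (V\<^sup>T * (N * V) + D)"
    using V N D by (simp, subst mult_four_block_mat) (auto simp: mult_assoc_dim)
  show ?thesis
    using compact_rep_congruence[OF rep _ _ _ RT] P U V unfolding eq by auto
qed

section \<open>One Broyden update\<close>

lemma sum_upto_2: "sum f {0..<Suc (Suc 0)} = f 0 + f (Suc 0)" for f :: "nat \<Rightarrow> real"
  by simp

text \<open>The inverse middle matrix contributed by one pair: \<open>diag (-\<alpha>, \<eta>)\<close> plus \<open>\<gamma>\<close> times the all-ones matrix.\<close>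

definition pair_core :: "real \<Rightarrow> real \<Rightarrow> real \<Rightarrow> real mat" where
  "pair_core \<alpha> \<eta> \<gamma> = mat_of_rows_list 2 [[- \<alpha> + \<gamma>, \<gamma>], [\<gamma>, \<eta> + \<gamma>]]"

definition step_selector :: "bool \<Rightarrow> real mat" where
  "step_selector sr1 = (if sr1 then mat_of_cols_list 2 [[- 1, 1]] else 1\<^sub>m 2)"

lemma mult_outer_prod_mult:
  assumes B: "B \<in> carrier_mat n n" and sym: "B\<^sup>T = B" and s: "s \<in> carrier_vec n"
  shows "B * outer_prod s s * B = outer_prod (B *\<^sub>v s) (B *\<^sub>v s)"
proof -
  have rc: "col B j = row B j" if "j < n" for j
    using B sym that by (metis carrier_matD(2) row_transpose)
  have "outer_prod s s * B = outer_prod s (B *\<^sub>v s)"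
    using B s rc
    by (intro eq_matI)
      (auto simp: outer_prod_def scalar_prod_def sum_distrib_left intro!: sum.cong)
  moreover have "B * outer_prod s v = outer_prod (B *\<^sub>v s) v" for v
    using B s
    by (intro eq_matI)
      (auto simp: outer_prod_def scalar_prod_def sum_distrib_right intro!: sum.cong)
  moreover have "outer_prod s s \<in> carrier_mat n n"
    using s by (auto simp: outer_prod_def)
  then have "B * outer_prod s s * B = B * (outer_prod s s * B)"
    using B by (intro assoc_mult_mat)
  ultimately show ?thesis by simp
qed

text \<open>Expanding \<open>w w\<^sup>T\<close> collects all terms of the update into a quadratic form in the two columns \<open>B s\<close> and \<open>y\<close>.\<close>

lemma broyden_update_two_column:
  assumes B: "B \<in> carrier_mat n n" and sym: "B\<^sup>T = B"
    and s: "s \<in> carrier_vec n" and y: "y \<in> carrier_vec n"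
    and \<eta>: "\<eta> = y \<bullet> s" and \<sigma>: "\<sigma> = s \<bullet> (B *\<^sub>v s)" and nz: "\<eta> \<noteq> 0" "\<sigma> \<noteq> 0"
  shows "broyden_update B s y \<phi> = B + mat_of_cols n [B *\<^sub>v s, y] *
    mat_of_rows_list 2 [[(\<phi> - 1) / \<sigma>, - (\<phi> / \<eta>)], [- (\<phi> / \<eta>), 1 / \<eta> + \<phi> * \<sigma> / \<eta>\<^sup>2]] *
    (mat_of_cols n [B *\<^sub>v s, y])\<^sup>T" (is "_ = B + ?W * ?Q * ?W\<^sup>T")
proof -
  let ?b = "B *\<^sub>v s"
  have b: "?b \<in> carrier_vec n" using B s by auto
  have WQ: "(?W * ?Q * ?W\<^sup>T) $$ (i, j) =
      ((\<phi> - 1) / \<sigma> * ?b $ i - \<phi> / \<eta> * y $ i) * ?b $ j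
      + (- (\<phi> / \<eta>) * ?b $ i + (1 / \<eta> + \<phi> * \<sigma> / \<eta>\<^sup>2) * y $ i) * y $ j" if "i < n" "j < n" for i j
    using that b y
    by (simp add: times_mat_def scalar_prod_def mat_of_cols_index mat_of_rows_list_def
        sum_upto_2 numeral_2_eq_2 mult_ac del: index_mult_mat_vec)
  show ?thesis
  proof (rule eq_matI)
    fix i j assume "i < dim_row (B + ?W * ?Q * ?W\<^sup>T)" "j < dim_col (B + ?W * ?Q * ?W\<^sup>T)"
    then have ij: "i < n" "j < n" using B by auto
    have "broyden_update B s y \<phi> $$ (i, j) = B $$ (i, j) - 1 / \<sigma> * (?b $ i * ?b $ j)
        + 1 / \<eta> * (y $ i * y $ j)
        + \<phi> * \<sigma> * ((1 / \<eta> * y $ i - 1 / \<sigma> * ?b $ i) * (1 / \<eta> * y $ j - 1 / \<sigma> * ?b $ j))"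
      unfolding broyden_update_def mult_outer_prod_mult[OF B sym s] broyden_w_def
        \<eta>[symmetric] \<sigma>[symmetric]
      using B b y ij by (simp add: outer_prod_def del: index_mult_mat_vec)
    also have "\<dots> = B $$ (i, j) + (?W * ?Q * ?W\<^sup>T) $$ (i, j)"
      unfolding WQ[OF ij] using nz by (simp add: field_simps power2_eq_square)
    finally show "broyden_update B s y \<phi> $$ (i, j) = (B + ?W * ?Q * ?W\<^sup>T) $$ (i, j)"
      using B ij by simp
  qed (use B b y in \<open>auto simp: broyden_update_def outer_prod_def broyden_w_def\<close>)
qed

text \<open>The middle matrix \<open>Q\<close> of the two-column form is inverted by the pair matrix unless \<open>\<phi>\<close> is the SR1
parameter. In that case \<open>Q\<close> has rank one with range spanned by \<open>(-1 1)\<^sup>T\<close>; the selector \<open>E\<close> then compresses the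
two columns to the single column \<open>y - B s\<close>.\<close>

lemma compact_rep_single_update:
  fixes \<phi> :: real
  assumes B: "B \<in> carrier_mat n n" and sym: "B\<^sup>T = B"
    and s: "s \<in> carrier_vec n" and y: "y \<in> carrier_vec n"
    and nz: "y \<bullet> s \<noteq> 0" "s \<bullet> (B *\<^sub>v s) \<noteq> 0"
  defines "E \<equiv> step_selector (is_SR1 B s y \<phi>)"
  shows "compact_rep n (dim_col E) B (mat_of_cols n [B *\<^sub>v s, y] * E)
    (E\<^sup>T * pair_core (s \<bullet> (B *\<^sub>v s)) (y \<bullet> s) (gamma_coeff B s y \<phi>) * E) (broyden_update B s y \<phi>)"
proof -
  define \<eta> \<sigma> where \<eta>: "\<eta> = y \<bullet> s" and \<sigma>: "\<sigma> = s \<bullet> (B *\<^sub>v s)"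
  have nz': "\<eta> \<noteq> 0" "\<sigma> \<noteq> 0" using nz \<eta> \<sigma> by auto
  let ?W = "mat_of_cols n [B *\<^sub>v s, y]"
  let ?\<gamma> = "gamma_coeff B s y \<phi>"
  let ?Q = "mat_of_rows_list 2 [[(\<phi> - 1) / \<sigma>, - (\<phi> / \<eta>)], [- (\<phi> / \<eta>), 1 / \<eta> + \<phi> * \<sigma> / \<eta>\<^sup>2]]"
  let ?G = "pair_core \<sigma> \<eta> ?\<gamma>"
  note upd = broyden_update_two_column[OF B sym s y \<eta> \<sigma> nz', of \<phi>]
  have W: "?W \<in> carrier_mat n 2" by (auto simp: numeral_2_eq_2)
  have Q: "?Q \<in> carrier_mat 2 2" by (auto simp: mat_of_rows_list_def)
  have G: "?G \<in> carrier_mat 2 2" by (auto simp: pair_core_def mat_of_rows_list_def)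
  show ?thesis
  proof (cases "is_SR1 B s y \<phi>")
    case False
    \<comment> \<open>The determinant of \<open>Q\<close> is \<open>- \<Delta> / (\<sigma> \<eta>\<^sup>2)\<close>.\<close>
    define \<Delta> where "\<Delta> = (1 - \<phi>) * \<eta> + \<phi> * \<sigma>"
    have \<Delta>: "\<Delta> \<noteq> 0"
    proof
      assume 0: "\<Delta> = 0"
      then have 1: "\<phi> * (\<eta> - \<sigma>) = \<eta>" by (simp add: \<Delta>_def algebra_simps)
      then have "\<eta> \<noteq> \<sigma>" using nz' by auto
      with 1 have "\<phi> = \<eta> / (\<eta> - \<sigma>)" by (simp add: field_simps)
      with \<open>\<eta> \<noteq> \<sigma>\<close> False show False unfolding is_SR1_def phi_SR1_def \<eta> \<sigma> by auto
    qed
    have "s \<bullet> y = \<eta>" using comm_scalar_prod[OF s y] \<eta> by simp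
    then have "?\<gamma> = \<phi> * inverse (- ((1 - \<phi>) / \<sigma>) - \<phi> / \<eta>)"
      using False unfolding gamma_coeff_def \<sigma> by simp
    also have "- ((1 - \<phi>) / \<sigma>) - \<phi> / \<eta> = - \<Delta> / (\<sigma> * \<eta>)"
      using nz' unfolding \<Delta>_def by (simp add: field_simps)
    finally have g: "?\<gamma> = - (\<phi> * \<sigma> * \<eta> / \<Delta>)" using nz' \<Delta> by (simp add: field_simps)
    have "?Q * ?G = 1\<^sub>m 2"
    proof (rule eq_matI)
      fix i j assume "i < dim_row (1\<^sub>m 2 :: real mat)" "j < dim_col (1\<^sub>m 2 :: real mat)"
      then have "i = 0 \<or> i = 1" "j = 0 \<or> j = 1" by auto
      then show "(?Q * ?G) $$ (i, j) = 1\<^sub>m 2 $$ (i, j)"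
        using nz' \<Delta>
        apply (auto simp: g pair_core_def mat_of_rows_list_def scalar_prod_def sum_upto_2 numeral_2_eq_2)
        apply (simp_all add: divide_simps)
        apply (simp_all add: \<Delta>_def algebra_simps power2_eq_square)
        done
    qed (use Q G in auto)
    moreover from this have "?G * ?Q = 1\<^sub>m 2"
      using mat_mult_left_right_inverse[OF Q G] by simp
    moreover have "?Q\<^sup>T = ?Q"
      by (rule eq_matI) (auto simp: mat_of_rows_list_def less_2_cases_iff numeral_2_eq_2 less_Suc_eq)
    moreover have "E = 1\<^sub>m 2" using False by (simp add: E_def step_selector_def)
    ultimately show ?thesis
      unfolding compact_rep_def using B W Q G upd
      by (intro conjI bexI[of _ ?Q]) (auto simp: \<eta> \<sigma>)
  next
    case True
    then have ne: "\<eta> \<noteq> \<sigma>" and phi: "\<phi> = \<eta> / (\<eta> - \<sigma>)"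
      unfolding is_SR1_def phi_SR1_def \<eta> \<sigma> by auto
    have g: "?\<gamma> = 0" using True by (simp add: gamma_coeff_def)
    have E: "E = mat_of_cols_list 2 [[- 1, 1]]" using True by (simp add: E_def step_selector_def)
    have Ec: "E \<in> carrier_mat 2 1" unfolding E mat_of_cols_list_def by auto
    \<comment> \<open>Compressed by \<open>E\<close>, the pair matrix with \<open>\<gamma> = 0\<close> is the number \<open>\<eta> - \<sigma>\<close>.\<close>
    define C where "C = mat 1 1 (\<lambda>_. 1 / (\<eta> - \<sigma>))"
    have C: "C \<in> carrier_mat 1 1" by (simp add: C_def)
    have N: "E\<^sup>T * ?G * E = mat 1 1 (\<lambda>_. \<eta> - \<sigma>)"
      unfolding g E
      by (rule eq_matI)
        (auto simp: pair_core_def mat_of_rows_list_def mat_of_cols_list_def scalar_prod_def sum_upto_2 numeral_2_eq_2)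
    have ECE: "E * C * E\<^sup>T = ?Q"
    proof (rule eq_matI)
      fix i j assume "i < dim_row ?Q" "j < dim_col ?Q"
      then have "i = 0 \<or> i = 1" "j = 0 \<or> j = 1" by (auto simp: mat_of_rows_list_def)
      then show "(E * C * E\<^sup>T) $$ (i, j) = ?Q $$ (i, j)"
        using nz' ne
        apply (auto simp: E C_def mat_of_cols_list_def mat_of_rows_list_def scalar_prod_def)
        apply (simp_all add: phi divide_simps)
        apply (simp_all add: algebra_simps power2_eq_square)
        done
    qed (auto simp: E mat_of_cols_list_def mat_of_rows_list_def)
    have "broyden_update B s y \<phi> = B + ?W * E * C * (?W * E)\<^sup>T"
      unfolding upd ECE[symmetric] using W Ec C
      by (simp add: transpose_mult_dim mult_assoc_dim carrier_matD[OF W] carrier_matD[OF Ec])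
    moreover have "C * (E\<^sup>T * ?G * E) = 1\<^sub>m 1" "(E\<^sup>T * ?G * E) * C = 1\<^sub>m 1" "C\<^sup>T = C"
      unfolding N C_def using ne
      by (auto intro!: eq_matI simp: scalar_prod_def)
    ultimately show ?thesis
      unfolding compact_rep_def using B W Ec C G
      by (intro conjI bexI[of _ C]) (auto simp: \<eta> \<sigma>)
  qed
qed

section \<open>Appending a Broyden update to a compact representation\<close>

lemma mult_mat_of_cols_zero:
  assumes "A \<in> carrier_mat n n" "s \<in> carrier_vec n"
  shows "A * mat_of_cols n [s, 0\<^sub>v n] = mat_of_cols n [A *\<^sub>v s, 0\<^sub>v n]"
  using assms
  by (intro eq_matI) (auto simp: mat_of_cols_index less_Suc_eq scalar_prod_def)

lemma compact_rep_symmetric: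
  assumes "compact_rep n m A P N A'" "A\<^sup>T = A"
  shows "A' \<in> carrier_mat n n" "A'\<^sup>T = A'"
proof -
  from assms(1) obtain M where A: "A \<in> carrier_mat n n" and P: "P \<in> carrier_mat n m"
    and M: "M \<in> carrier_mat m m" "M\<^sup>T = M" and A': "A' = A + P * M * P\<^sup>T"
    unfolding compact_rep_def by auto
  show "A' \<in> carrier_mat n n" unfolding A' using A P M by auto
  have "P * M * P\<^sup>T \<in> carrier_mat n n" using P M by auto
  moreover have "(P * M * P\<^sup>T)\<^sup>T = P * M * P\<^sup>T"
    using M(2) by (simp add: transpose_mult_dim mult_assoc_dim carrier_matD[OF P] carrier_matD[OF M(1)])
  ultimately show "A'\<^sup>T = A'" unfolding A' using A assms(2) by (simp add: transpose_add)
qed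

lemma step_selector_carrier: "step_selector b \<in> carrier_mat 2 (dim_col (step_selector b))"
  by (auto simp: step_selector_def mat_of_cols_list_def)

lemma congruence_add:
  fixes X Y E :: "real mat"
  assumes X: "X \<in> carrier_mat p p" and Y: "Y \<in> carrier_mat p p" and E: "E \<in> carrier_mat p r"
  shows "E\<^sup>T * X * E + E\<^sup>T * Y * E = E\<^sup>T * (X + Y) * E"
proof -
  have Et: "E\<^sup>T \<in> carrier_mat r p" using E by simp
  show ?thesis
    unfolding mult_add_distrib_mat[OF Et X Y]
    by (rule add_mult_distrib_mat[OF mult_carrier_mat[OF Et X] mult_carrier_mat[OF Et Y] E, symmetric])
qed

text \<open>Writing \<open>B = B\<^sub>0 + K\<close>, one has \<open>(B s  y) = (B\<^sub>0 s  y) + K (s  0)\<close>, and \<open>K (s  0) = P M P\<^sup>T (s  0)\<close> lies in the range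
of \<open>P\<close>. The congruence that removes this part adds \<open>s\<^sup>T K s\<close> to the entry \<open>-s\<^sup>T B s + \<gamma>\<close> of the pair matrix, so that
the matrix \<open>B\<close> of the current iterate disappears from it except through \<open>\<gamma>\<close> and \<open>E\<close>.\<close>

lemma compact_rep_broyden_step:
  fixes \<phi> :: real
  assumes rep: "compact_rep n m B\<^sub>0 P N B" and sym0: "B\<^sub>0\<^sup>T = B\<^sub>0"
    and s: "s \<in> carrier_vec n" and y: "y \<in> carrier_vec n"
    and nz: "y \<bullet> s \<noteq> 0" "s \<bullet> (B *\<^sub>v s) \<noteq> 0"
  defines "E \<equiv> step_selector (is_SR1 B s y \<phi>)"
  shows "compact_rep n (m + dim_col E) B\<^sub>0 (hcat P (mat_of_cols n [B\<^sub>0 *\<^sub>v s, y] * E))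
    (four_block_mat N (- (P\<^sup>T * mat_of_cols n [s, 0\<^sub>v n] * E))
       (- ((P\<^sup>T * mat_of_cols n [s, 0\<^sub>v n] * E)\<^sup>T))
       (E\<^sup>T * pair_core (s \<bullet> (B\<^sub>0 *\<^sub>v s)) (y \<bullet> s) (gamma_coeff B s y \<phi>) * E))
    (broyden_update B s y \<phi>)"
proof -
  from rep obtain M where B0: "B\<^sub>0 \<in> carrier_mat n n" and P: "P \<in> carrier_mat n m"
    and N: "N \<in> carrier_mat m m" and M: "M \<in> carrier_mat m m" and Msym: "M\<^sup>T = M"
    and MN: "M * N = 1\<^sub>m m" and NM: "N * M = 1\<^sub>m m" and B_eq: "B = B\<^sub>0 + P * M * P\<^sup>T"
    unfolding compact_rep_def by auto
  let ?\<gamma> = "gamma_coeff B s y \<phi>"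
  let ?S = "mat_of_cols n [s, 0\<^sub>v n]"
  let ?W\<^sub>0 = "mat_of_cols n [B\<^sub>0 *\<^sub>v s, y]"
  define r where "r = dim_col E"
  have E: "E \<in> carrier_mat 2 r" unfolding E_def r_def by (rule step_selector_carrier)
  define K where "K = P * M * P\<^sup>T"
  have K: "K \<in> carrier_mat n n" unfolding K_def using P M by auto
  \<comment> \<open>The coordinates with respect to \<open>P\<close> of the part of the new columns to be eliminated.\<close>
  define V where "V = M * (P\<^sup>T * ?S * E)"
  have S: "?S \<in> carrier_mat n 2" and W0: "?W\<^sub>0 \<in> carrier_mat n 2" by (auto simp: numeral_2_eq_2)
  have V: "V \<in> carrier_mat m r" unfolding V_def using M P S E by auto
  have U: "?W\<^sub>0 * E \<in> carrier_mat n r" using W0 E by auto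
  have F: "P\<^sup>T * ?S * E \<in> carrier_mat m r" using P S E by auto
  note dims = carrier_matD[OF P] carrier_matD[OF M] carrier_matD[OF N] carrier_matD[OF S]
    carrier_matD[OF E]
  have NV: "N * V = P\<^sup>T * ?S * E"
    unfolding V_def using assoc_mult_mat[OF N M F] NM left_mult_one_mat[OF F] by simp
  have VT: "V\<^sup>T = (P\<^sup>T * ?S * E)\<^sup>T * M"
    unfolding V_def transpose_mult[OF M F] Msym ..
  have VN: "V\<^sup>T * N = (P\<^sup>T * ?S * E)\<^sup>T"
  proof -
    have "V\<^sup>T * N = (P\<^sup>T * ?S * E)\<^sup>T * (M * N)"
      unfolding VT using F M N by (intro assoc_mult_mat) auto
    then show ?thesis unfolding MN using F by (metis right_mult_one_mat transpose_carrier_mat)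
  qed
  have PV: "P * V = K * ?S * E"
    unfolding V_def K_def by (simp add: mult_assoc_dim dims)
  have "?W\<^sub>0 + K * ?S = mat_of_cols n [B *\<^sub>v s, y]"
    unfolding mult_mat_of_cols_zero[OF K s] B_eq K_def[symmetric]
    using B0 K s y
    by (intro eq_matI)
      (auto simp: mat_of_cols_index less_Suc_eq add_mult_distrib_mat_vec[of _ n n] simp del: index_mult_mat_vec)
  then have W: "?W\<^sub>0 * E + P * V = mat_of_cols n [B *\<^sub>v s, y] * E"
    unfolding PV using add_mult_distrib_mat[OF W0 mult_carrier_mat[OF K S] E] by simp
  have VNV: "V\<^sup>T * (N * V) = E\<^sup>T * (?S\<^sup>T * (K * ?S)) * E"
    unfolding NV VT K_def by (simp add: transpose_mult_dim mult_assoc_dim dims)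
  have Ks: "K *\<^sub>v s \<in> carrier_vec n" and B0s: "B\<^sub>0 *\<^sub>v s \<in> carrier_vec n" using K B0 s by auto
  have sum: "s \<bullet> (B *\<^sub>v s) = s \<bullet> (B\<^sub>0 *\<^sub>v s) + s \<bullet> (K *\<^sub>v s)"
    unfolding B_eq K_def[symmetric] using B0 K s Ks B0s
    by (simp add: add_mult_distrib_mat_vec[of _ n n] scalar_prod_add_distrib[of _ n])
  have G: "pair_core a b c \<in> carrier_mat 2 2" for a b c
    by (auto simp: pair_core_def mat_of_rows_list_def)
  have SKS: "?S\<^sup>T * (K * ?S) \<in> carrier_mat 2 2"
    using mult_carrier_mat[OF K S] S by auto
  have "?S\<^sup>T * (K * ?S) + pair_core (s \<bullet> (B *\<^sub>v s)) (y \<bullet> s) ?\<gamma>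
      = pair_core (s \<bullet> (B\<^sub>0 *\<^sub>v s)) (y \<bullet> s) ?\<gamma>"
    unfolding mult_mat_of_cols_zero[OF K s] sum
    using s Ks
    by (intro eq_matI)
      (auto simp: pair_core_def mat_of_rows_list_def numeral_2_eq_2 less_Suc_eq col_mat_of_cols row_transpose
        simp del: index_mult_mat_vec)
  then have D: "V\<^sup>T * (N * V) + E\<^sup>T * pair_core (s \<bullet> (B *\<^sub>v s)) (y \<bullet> s) ?\<gamma> * E
      = E\<^sup>T * pair_core (s \<bullet> (B\<^sub>0 *\<^sub>v s)) (y \<bullet> s) ?\<gamma> * E"
    unfolding VNV using congruence_add[OF SKS G E] by simp
  have rep2: "compact_rep n r B (?W\<^sub>0 * E + P * V)
      (E\<^sup>T * pair_core (s \<bullet> (B *\<^sub>v s)) (y \<bullet> s) ?\<gamma> * E) (broyden_update B s y \<phi>)"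
    unfolding W unfolding r_def E_def
    by (rule compact_rep_single_update[OF compact_rep_symmetric[OF rep sym0] s y nz])
  show ?thesis
    using compact_rep_compose[OF rep rep2 U V] unfolding D unfolding NV VN r_def .
qed

section \<open>The permutation of the columns\<close>

text \<open>The column in which row \<open>i\<close> of the permutation matrix has its entry \<open>1\<close>. The formula covers \<open>k = 0\<close> as well.\<close>

definition Pi_index :: "nat \<Rightarrow> nat \<Rightarrow> nat" where
  "Pi_index k i = (if i < k then i else if i < 2 * k then Suc i else if i = 2 * k then k else i)"

lemma Pi_index_less: "i < 2 * Suc k \<Longrightarrow> Pi_index k i < 2 * Suc k"
  by (auto simp: Pi_index_def)

lemma Pi_mat_carrier: "Pi_mat k \<in> carrier_mat (2 * Suc k) (2 * Suc k)"
  by (auto simp: Pi_mat_def)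

lemma Pi_mat_index:
  assumes "i < 2 * Suc k" "j < 2 * Suc k"
  shows "Pi_mat k $$ (i, j) = (if j = Pi_index k i then 1 else 0)"
proof (cases "k = 0")
  case True
  with assms show ?thesis by (auto simp: Pi_mat_def Pi_index_def)
next
  case False
  \<comment> \<open>Upper and lower rows, left and right columns of the permutation matrix.\<close>
  define TL TR BL BR :: "real mat"
    where "TL = four_block_mat (1\<^sub>m k) (0\<^sub>m k 1) (0\<^sub>m k k) (0\<^sub>m k 1)"
      and "TR = four_block_mat (0\<^sub>m k k) (0\<^sub>m k 1) (1\<^sub>m k) (0\<^sub>m k 1)"
      and "BL = four_block_mat (0\<^sub>m 1 k) (1\<^sub>m 1) (0\<^sub>m 1 k) (0\<^sub>m 1 1)"
      and "BR = four_block_mat (0\<^sub>m 1 k) (0\<^sub>m 1 1) (0\<^sub>m 1 k) (1\<^sub>m 1)"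
  note defs = TL_def TR_def BL_def BR_def
  have Pi: "Pi_mat k = four_block_mat TL TR BL BR"
    using False by (simp add: Pi_mat_def defs)
  have dims: "dim_row TL = k + k" "dim_col TL = Suc k" "dim_row BR = 2" "dim_col BR = Suc k"
    by (simp_all add: defs)
  have TL: "TL $$ (i, j) = (if i < k \<and> j = i then 1 else 0)" if "i < k + k" "j < Suc k" for i j
    using that by (auto simp: TL_def)
  have TR: "TR $$ (i, j) = (if k \<le> i \<and> j = i - k then 1 else 0)" if "i < k + k" "j < Suc k" for i j
    using that by (auto simp: TR_def)
  have BL: "BL $$ (i, j) = (if i = 0 \<and> j = k then 1 else 0)" if "i < 2" "j < Suc k" for i j
    using that by (auto simp: BL_def)
  have BR: "BR $$ (i, j) = (if i = 1 \<and> j = k then 1 else 0)" if "i < 2" "j < Suc k" for i j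
    using that by (auto simp: BR_def)
  have "Pi_mat k $$ (i, j) = (if i < k + k
      then if j < Suc k then TL $$ (i, j) else TR $$ (i, j - Suc k)
      else if j < Suc k then BL $$ (i - (k + k), j) else BR $$ (i - (k + k), j - Suc k))"
    unfolding Pi using assms by (subst index_mat_four_block(1)) (auto simp: dims)
  also have "\<dots> = (if j = Pi_index k i then 1 else 0)"
  proof (cases "i < k + k"; cases "j < Suc k")
    assume "i < k + k" "j < Suc k"
    then show ?thesis by (auto simp: TL Pi_index_def)
  next
    assume "i < k + k" "\<not> j < Suc k"
    moreover from this have "j - Suc k < Suc k" using assms by auto
    ultimately show ?thesis by (auto simp: TR Pi_index_def)
  next
    assume "\<not> i < k + k" "j < Suc k"
    moreover from this have "i - (k + k) < 2" using assms by auto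
    ultimately show ?thesis using assms by (auto simp: BL Pi_index_def)
  next
    assume "\<not> i < k + k" "\<not> j < Suc k"
    moreover from this have "i - (k + k) < 2" "j - Suc k < Suc k" using assms by auto
    ultimately show ?thesis using assms by (auto simp: BR Pi_index_def)
  qed
  finally show ?thesis .
qed

lemma mult_Pi_mat_transpose:
  assumes A: "A \<in> carrier_mat r (2 * Suc k)"
  shows "A * (Pi_mat k)\<^sup>T = mat r (2 * Suc k) (\<lambda>(i, j). A $$ (i, Pi_index k j))"
proof (rule eq_matI)
  fix i j assume "i < dim_row (mat r (2 * Suc k) (\<lambda>(i, j). A $$ (i, Pi_index k j)))"
    "j < dim_col (mat r (2 * Suc k) (\<lambda>(i, j). A $$ (i, Pi_index k j)))"
  then have i: "i < r" and j: "j < 2 * Suc k" by auto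
  have "(A * (Pi_mat k)\<^sup>T) $$ (i, j) = (\<Sum>l = 0..<2 * Suc k. A $$ (i, l) * Pi_mat k $$ (j, l))"
    using A i j carrier_matD[OF Pi_mat_carrier[of k]] by (simp add: scalar_prod_def del: mult_Suc_right)
  also have "\<dots> = (\<Sum>l = 0..<2 * Suc k. if l = Pi_index k j then A $$ (i, l) else 0)"
    using j by (intro sum.cong) (auto simp: Pi_mat_index simp del: mult_Suc_right)
  also have "\<dots> = A $$ (i, Pi_index k j)"
    using Pi_index_less[OF j] by (subst sum.delta) auto
  finally show "(A * (Pi_mat k)\<^sup>T) $$ (i, j)
      = mat r (2 * Suc k) (\<lambda>(i, j). A $$ (i, Pi_index k j)) $$ (i, j)"
    using i j by simp
qed (use A carrier_matD[OF Pi_mat_carrier[of k]] in auto)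

lemma Pi_mat_mult:
  assumes A: "A \<in> carrier_mat (2 * Suc k) c"
  shows "Pi_mat k * A = mat (2 * Suc k) c (\<lambda>(i, j). A $$ (Pi_index k i, j))"
proof -
  have "Pi_mat k * A = (A\<^sup>T * (Pi_mat k)\<^sup>T)\<^sup>T"
    using transpose_mult[OF Pi_mat_carrier A] by (metis transpose_transpose)
  also have "\<dots> = (mat c (2 * Suc k) (\<lambda>(i, j). A\<^sup>T $$ (i, Pi_index k j)))\<^sup>T"
    using A by (simp only: mult_Pi_mat_transpose transpose_carrier_mat)
  also have "\<dots> = mat (2 * Suc k) c (\<lambda>(i, j). A $$ (Pi_index k i, j))"
  proof (rule eq_matI)
    fix i j assume "i < dim_row (mat (2 * Suc k) c (\<lambda>(i, j). A $$ (Pi_index k i, j)))"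
      "j < dim_col (mat (2 * Suc k) c (\<lambda>(i, j). A $$ (Pi_index k i, j)))"
    then have "i < 2 * Suc k" "j < c" by auto
    then show "(mat c (2 * Suc k) (\<lambda>(i, j). A\<^sup>T $$ (i, Pi_index k j)))\<^sup>T $$ (i, j)
        = mat (2 * Suc k) c (\<lambda>(i, j). A $$ (Pi_index k i, j)) $$ (i, j)"
      using A Pi_index_less[of i k] by (simp del: mult_Suc_right)
  qed auto
  finally show ?thesis .
qed

lemma Pi_mat_conjugate_index:
  assumes A: "A \<in> carrier_mat (2 * Suc k) (2 * Suc k)" and ij: "i < 2 * Suc k" "j < 2 * Suc k"
  shows "(Pi_mat k * A * (Pi_mat k)\<^sup>T) $$ (i, j) = A $$ (Pi_index k i, Pi_index k j)"
proof -
  have "Pi_mat k * A \<in> carrier_mat (2 * Suc k) (2 * Suc k)"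
    using A Pi_mat_carrier by (rule mult_carrier_mat[rotated])
  from mult_Pi_mat_transpose[OF this] show ?thesis
    using ij Pi_index_less[of j k] by (simp add: Pi_mat_mult[OF A] del: mult_Suc_right)
qed

section \<open>The middle matrix bordered by the newest pair\<close>

text \<open>Columns \<open>B\<^sub>0 s\<^sub>j\<close> are labelled \<open>(True, j)\<close> and columns \<open>y\<^sub>j\<close> are labelled \<open>(False, j)\<close>. Expressed by labels, the entries
of the matrices concerned do not depend on how many pairs there are, and the permutation
becomes invisible: after it, an older column keeps its label, and the newest pair comes last.\<close>

definition column_label :: "nat \<Rightarrow> nat \<Rightarrow> bool \<times> nat" where
  "column_label k i = (if i \<le> k then (True, i) else (False, i - Suc k))"

lemma column_label_Pi_index:
  "i < 2 * Suc k \<Longrightarrow> column_label (Suc k) (Pi_index (Suc k) i) = column_label k i"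
  "column_label (Suc k) (Pi_index (Suc k) (2 * Suc k)) = (True, Suc k)"
  "column_label (Suc k) (Pi_index (Suc k) (Suc (2 * Suc k))) = (False, Suc k)"
  by (auto simp: column_label_def Pi_index_def)

lemma column_label_bound: "i < 2 * Suc k \<Longrightarrow> snd (column_label k i) \<le> k"
  by (auto simp: column_label_def)

fun Psi_column :: "real mat \<Rightarrow> (nat \<Rightarrow> real vec) \<Rightarrow> (nat \<Rightarrow> real vec) \<Rightarrow> bool \<times> nat \<Rightarrow> real vec" where
  "Psi_column B\<^sub>0 s y (True, j) = B\<^sub>0 *\<^sub>v s j"
| "Psi_column B\<^sub>0 s y (False, j) = y j"

fun core_entry :: "real mat \<Rightarrow> (nat \<Rightarrow> real vec) \<Rightarrow> (nat \<Rightarrow> real vec) \<Rightarrow> (nat \<Rightarrow> real) \<Rightarrow>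
    bool \<times> nat \<Rightarrow> bool \<times> nat \<Rightarrow> real" where
  "core_entry B\<^sub>0 s y \<gamma> (True, i) (True, j) = - (s i \<bullet> (B\<^sub>0 *\<^sub>v s j)) + (if i = j then \<gamma> i else 0)"
| "core_entry B\<^sub>0 s y \<gamma> (True, i) (False, j) =
     - (if j < i then s i \<bullet> y j else 0) + (if i = j then \<gamma> i else 0)"
| "core_entry B\<^sub>0 s y \<gamma> (False, i) (True, j) =
     - (if i < j then s j \<bullet> y i else 0) + (if i = j then \<gamma> i else 0)"
| "core_entry B\<^sub>0 s y \<gamma> (False, i) (False, j) = (if i = j then s i \<bullet> y i + \<gamma> i else 0)"

text \<open>The large matrix of the closed form, with the coefficients \<open>\<gamma>\<close> left arbitrary, since reordering its rows
and columns does not involve the iterates.\<close>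

definition core_mat :: "nat \<Rightarrow> real mat \<Rightarrow> (nat \<Rightarrow> real vec) \<Rightarrow> (nat \<Rightarrow> real vec) \<Rightarrow> (nat \<Rightarrow> real) \<Rightarrow> nat \<Rightarrow> real mat" where
  "core_mat n B\<^sub>0 s y \<gamma> k =
     (let S = vecs_mat n s k; Y = vecs_mat n y k;
          L = strict_lower_part (S\<^sup>T * Y); D = diag_part (S\<^sup>T * Y); G = mat_diag (Suc k) \<gamma>
      in four_block_mat (- (S\<^sup>T * B\<^sub>0 * S) + G) (- L + G) (- (L\<^sup>T) + G) (D + G))"

lemma vecs_mat_carrier: "vecs_mat n v k \<in> carrier_mat n (Suc k)"
  by (auto simp: vecs_mat_def)

lemma col_vecs_mat: "j \<le> k \<Longrightarrow> v j \<in> carrier_vec n \<Longrightarrow> col (vecs_mat n v k) j = v j"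
  unfolding vecs_mat_def by (subst col_mat_of_cols) (auto simp del: upt_Suc)

lemma Psi_mat_carrier:
  "B\<^sub>0 \<in> carrier_mat n n \<Longrightarrow> Psi_mat n B\<^sub>0 s y k \<in> carrier_mat n (2 * Suc k)"
  by (auto simp: Psi_mat_def vecs_mat_def hcat_def)

lemma Psi_mat_index:
  assumes B0: "B\<^sub>0 \<in> carrier_mat n n" and ij: "i < n" "j < 2 * Suc k"
    and s: "\<And>j. j \<le> k \<Longrightarrow> s j \<in> carrier_vec n" and y: "\<And>j. j \<le> k \<Longrightarrow> y j \<in> carrier_vec n"
  shows "Psi_mat n B\<^sub>0 s y k $$ (i, j) = Psi_column B\<^sub>0 s y (column_label k j) $ i"
proof (cases "j \<le> k")
  case True
  then show ?thesis
    using B0 ij carrier_matD[OF vecs_mat_carrier[of n s k]] carrier_matD[OF vecs_mat_carrier[of n y k]]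
    by (simp add: Psi_mat_def hcat_def column_label_def col_vecs_mat s)
next
  case False
  then have j: "j - Suc k \<le> k" using ij by auto
  have "vecs_mat n y k $$ (i, j - Suc k) = col (vecs_mat n y k) (j - Suc k) $ i"
    using ij j carrier_matD[OF vecs_mat_carrier[of n y k]] by simp
  also have "\<dots> = y (j - Suc k) $ i" using j y by (simp add: col_vecs_mat)
  finally show ?thesis
    using False B0 ij j carrier_matD[OF vecs_mat_carrier[of n s k]] carrier_matD[OF vecs_mat_carrier[of n y k]]
    by (simp add: Psi_mat_def hcat_def column_label_def)
qed

lemma core_mat_carrier: "core_mat n B\<^sub>0 s y \<gamma> k \<in> carrier_mat (2 * Suc k) (2 * Suc k)"
  by (auto simp: core_mat_def Let_def mat_diag_def strict_lower_part_def diag_part_def vecs_mat_def)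

lemma core_mat_index:
  assumes B0: "B\<^sub>0 \<in> carrier_mat n n" and ij: "i < 2 * Suc k" "j < 2 * Suc k"
    and s: "\<And>j. j \<le> k \<Longrightarrow> s j \<in> carrier_vec n" and y: "\<And>j. j \<le> k \<Longrightarrow> y j \<in> carrier_vec n"
  shows "core_mat n B\<^sub>0 s y \<gamma> k $$ (i, j) = core_entry B\<^sub>0 s y \<gamma> (column_label k i) (column_label k j)"
proof -
  let ?S = "vecs_mat n s k" and ?Y = "vecs_mat n y k"
  note S = vecs_mat_carrier[of n s k] and Y = vecs_mat_carrier[of n y k]
  have SY: "(?S\<^sup>T * ?Y) $$ (i, j) = s i \<bullet> y j" if "i \<le> k" "j \<le> k" for i j
    using that S Y by (simp add: col_vecs_mat s y)
  have SBS: "(?S\<^sup>T * B\<^sub>0 * ?S) $$ (i, j) = s i \<bullet> (B\<^sub>0 *\<^sub>v s j)" if "i \<le> k" "j \<le> k" for i j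
  proof -
    have "?S\<^sup>T * B\<^sub>0 * ?S = ?S\<^sup>T * (B\<^sub>0 * ?S)"
      using S B0 by (intro assoc_mult_mat) auto
    moreover have "col (B\<^sub>0 * ?S) j = B\<^sub>0 *\<^sub>v s j"
      using that by (subst col_mult2[OF B0 S]) (auto simp: col_vecs_mat s)
    ultimately show ?thesis using that S B0 by (simp add: col_vecs_mat s del: col_mult2)
  qed
  note dims = carrier_matD[OF S] carrier_matD[OF Y]
  have "i \<le> k \<or> (\<not> i \<le> k \<and> i - Suc k \<le> k)" "j \<le> k \<or> (\<not> j \<le> k \<and> j - Suc k \<le> k)"
    using ij by auto
  then show ?thesis
    using ij unfolding core_mat_def Let_def column_label_def
    by (elim disjE conjE)
      (simp_all add: dims mat_diag_def strict_lower_part_def diag_part_def SY SBS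
        del: index_mult_mat(1))
qed

lemma core_entry_symmetric:
  assumes B0: "B\<^sub>0 \<in> carrier_mat n n" and sym: "B\<^sub>0\<^sup>T = B\<^sub>0"
    and s: "s (snd a) \<in> carrier_vec n" "s (snd b) \<in> carrier_vec n"
  shows "core_entry B\<^sub>0 s y \<gamma> a b = core_entry B\<^sub>0 s y \<gamma> b a"
proof -
  have "s j \<bullet> (B\<^sub>0 *\<^sub>v s i) = s i \<bullet> (B\<^sub>0 *\<^sub>v s j)"
    if "s i \<in> carrier_vec n" "s j \<in> carrier_vec n" for i j
    using transpose_vec_mult_scalar[OF B0 that]
      comm_scalar_prod[OF that(1) mult_mat_vec_carrier[OF B0 that(2)]] sym by simp
  moreover obtain t i u j where "a = (t, i)" "b = (u, j)" by (cases a; cases b) auto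
  ultimately show ?thesis
    using s by (cases t; cases u) auto
qed

text \<open>The newest pair against an older column \<open>l\<close>. For \<open>B\<^sub>0 s\<^sub>j\<close> the inner product arises by the symmetry of \<open>B\<^sub>0\<close>, for
\<open>y\<^sub>j\<close> from the strictly lower part of \<open>S\<^sup>T Y\<close>; the column of the newest \<open>y\<close> meets \<open>L\<close> only
above the diagonal, and the diagonal matrices \<open>D\<close> and \<open>\<Gamma>\<close> only off the diagonal.\<close>

lemma core_entry_new_column:
  assumes B0: "B\<^sub>0 \<in> carrier_mat n n" and sym: "B\<^sub>0\<^sup>T = B\<^sub>0"
    and s: "\<And>j. j \<le> Suc k \<Longrightarrow> s j \<in> carrier_vec n" and y: "\<And>j. j \<le> Suc k \<Longrightarrow> y j \<in> carrier_vec n"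
    and l: "snd l \<le> k"
  shows "core_entry B\<^sub>0 s y \<gamma> l (True, Suc k) = - (Psi_column B\<^sub>0 s y l \<bullet> s (Suc k))"
    and "core_entry B\<^sub>0 s y \<gamma> l (False, Suc k) = 0"
proof -
  obtain t j where lj: "l = (t, j)" "j \<le> k" using l by (cases l) auto
  have sj: "s j \<in> carrier_vec n" "y j \<in> carrier_vec n" "s (Suc k) \<in> carrier_vec n"
    using lj s y by auto
  have 1: "s j \<bullet> (B\<^sub>0 *\<^sub>v s (Suc k)) = (B\<^sub>0 *\<^sub>v s j) \<bullet> s (Suc k)"
    using transpose_vec_mult_scalar[OF B0 sj(3) sj(1)] sym by simp
  have 2: "s (Suc k) \<bullet> y j = y j \<bullet> s (Suc k)"
    using sj by (intro comm_scalar_prod) auto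
  show "core_entry B\<^sub>0 s y \<gamma> l (True, Suc k) = - (Psi_column B\<^sub>0 s y l \<bullet> s (Suc k))"
    using lj 1 2 by (cases t) auto
  show "core_entry B\<^sub>0 s y \<gamma> l (False, Suc k) = 0"
    using lj by (cases t) auto
qed

lemma lt_2_Suc_Suc: "(i < 2 * Suc (Suc k)) = (i < 2 * Suc k \<or> i = 2 * Suc k \<or> i = Suc (2 * Suc k))"
  by auto

lemma Psi_mat_Suc_Pi:
  assumes B0: "B\<^sub>0 \<in> carrier_mat n n"
    and s: "\<And>j. j \<le> Suc k \<Longrightarrow> s j \<in> carrier_vec n" and y: "\<And>j. j \<le> Suc k \<Longrightarrow> y j \<in> carrier_vec n"
  shows "Psi_mat n B\<^sub>0 s y (Suc k) * (Pi_mat (Suc k))\<^sup>T =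
    hcat (Psi_mat n B\<^sub>0 s y k) (mat_of_cols n [B\<^sub>0 *\<^sub>v s (Suc k), y (Suc k)])" (is "_ = hcat ?P ?W")
proof (rule eq_matI)
  note P = Psi_mat_carrier[OF B0, of s y k]
  note P' = Psi_mat_carrier[OF B0, of s y "Suc k"]
  note dims = carrier_matD[OF P]
  fix i j assume "i < dim_row (hcat ?P ?W)" "j < dim_col (hcat ?P ?W)"
  then have i: "i < n" and j: "j < 2 * Suc (Suc k)" using dims by auto
  have "(Psi_mat n B\<^sub>0 s y (Suc k) * (Pi_mat (Suc k))\<^sup>T) $$ (i, j)
      = Psi_column B\<^sub>0 s y (column_label (Suc k) (Pi_index (Suc k) j)) $ i"
    using i j Pi_index_less[OF j]
    by (simp add: mult_Pi_mat_transpose[OF P'] Psi_mat_index[OF B0] s y del: mult_Suc_right)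
  also have "\<dots> = hcat ?P ?W $$ (i, j)"
    using j i unfolding lt_2_Suc_Suc
    by (elim disjE)
      (simp_all add: hcat_index dims column_label_Pi_index Psi_mat_index[OF B0] s y mat_of_cols_index
        del: mult_Suc_right)
  finally show "(Psi_mat n B\<^sub>0 s y (Suc k) * (Pi_mat (Suc k))\<^sup>T) $$ (i, j) = hcat ?P ?W $$ (i, j)" .
qed (use Psi_mat_carrier[OF B0, of s y k] Psi_mat_carrier[OF B0, of s y "Suc k"] Pi_mat_carrier[of "Suc k"] in auto)

text \<open>In the reordered matrix the older pairs occupy the leading block and the newest pair the corner, and the border \<open>F\<close>
is read off from the entries of the newest pair against the older columns.\<close>

lemma core_mat_Suc_Pi:
  assumes B0: "B\<^sub>0 \<in> carrier_mat n n" and sym: "B\<^sub>0\<^sup>T = B\<^sub>0"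
    and s: "\<And>j. j \<le> Suc k \<Longrightarrow> s j \<in> carrier_vec n" and y: "\<And>j. j \<le> Suc k \<Longrightarrow> y j \<in> carrier_vec n"
  defines "F \<equiv> (Psi_mat n B\<^sub>0 s y k)\<^sup>T * mat_of_cols n [s (Suc k), 0\<^sub>v n]"
  shows "Pi_mat (Suc k) * core_mat n B\<^sub>0 s y \<gamma> (Suc k) * (Pi_mat (Suc k))\<^sup>T =
    four_block_mat (core_mat n B\<^sub>0 s y \<gamma> k) (- F) (- F\<^sup>T)
      (pair_core (s (Suc k) \<bullet> (B\<^sub>0 *\<^sub>v s (Suc k))) (y (Suc k) \<bullet> s (Suc k)) (\<gamma> (Suc k)))"
    (is "?L = four_block_mat ?C _ _ ?G")
proof (rule eq_matI)
  note P = Psi_mat_carrier[OF B0, of s y k]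
  have F: "F \<in> carrier_mat (2 * Suc k) 2" unfolding F_def using P by (auto simp: numeral_2_eq_2)
  have G: "?G \<in> carrier_mat 2 2" by (auto simp: pair_core_def mat_of_rows_list_def)
  note C = core_mat_carrier[of n B\<^sub>0 s y \<gamma> k]
  note dims = carrier_matD[OF P] carrier_matD[OF F] carrier_matD[OF G] carrier_matD[OF C]
  have sk: "s (Suc k) \<in> carrier_vec n" by (simp add: s)
  have colP: "col (Psi_mat n B\<^sub>0 s y k) i = Psi_column B\<^sub>0 s y (column_label k i)" if "i < 2 * Suc k" for i
  proof (rule eq_vecI)
    have len: "dim_vec (Psi_column B\<^sub>0 s y (column_label k i)) = n"
      using that B0 carrier_vecD[OF y, of "i - Suc k"] by (auto simp: column_label_def)
    then show "dim_vec (col (Psi_mat n B\<^sub>0 s y k) i) = dim_vec (Psi_column B\<^sub>0 s y (column_label k i))"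
      using dims by simp
    fix l assume "l < dim_vec (Psi_column B\<^sub>0 s y (column_label k i))"
    with len that show "col (Psi_mat n B\<^sub>0 s y k) i $ l = Psi_column B\<^sub>0 s y (column_label k i) $ l"
      using dims by (simp add: Psi_mat_index[OF B0] s y del: mult_Suc_right)
  qed
  have F0: "F $$ (i, 0) = Psi_column B\<^sub>0 s y (column_label k i) \<bullet> s (Suc k)"
    and F1: "F $$ (i, Suc 0) = 0" if "i < 2 * Suc k" for i
    unfolding F_def using that dims sk P
    by (simp_all add: colP[OF that, symmetric] col_mat_of_cols del: mult_Suc_right)
  have new: "core_entry B\<^sub>0 s y \<gamma> (column_label k i) (True, Suc k) = - F $$ (i, 0)"
     "core_entry B\<^sub>0 s y \<gamma> (column_label k i) (False, Suc k) = - F $$ (i, Suc 0)"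
     "core_entry B\<^sub>0 s y \<gamma> (True, Suc k) (column_label k i) = - F $$ (i, 0)"
     "core_entry B\<^sub>0 s y \<gamma> (False, Suc k) (column_label k i) = - F $$ (i, Suc 0)"
    if i: "i < 2 * Suc k" for i
  proof -
    note b = column_label_bound[OF i]
    have n: "core_entry B\<^sub>0 s y \<gamma> (column_label k i) (True, Suc k)
        = - (Psi_column B\<^sub>0 s y (column_label k i) \<bullet> s (Suc k))"
      "core_entry B\<^sub>0 s y \<gamma> (column_label k i) (False, Suc k) = 0"
      by (rule core_entry_new_column[OF B0 sym _ _ b]; simp add: s y)+
    have sw: "core_entry B\<^sub>0 s y \<gamma> (t, Suc k) (column_label k i)
        = core_entry B\<^sub>0 s y \<gamma> (column_label k i) (t, Suc k)" for t
      using b by (intro core_entry_symmetric[OF B0 sym]) (auto simp: s)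
    show "core_entry B\<^sub>0 s y \<gamma> (column_label k i) (True, Suc k) = - F $$ (i, 0)"
     "core_entry B\<^sub>0 s y \<gamma> (column_label k i) (False, Suc k) = - F $$ (i, Suc 0)"
     "core_entry B\<^sub>0 s y \<gamma> (True, Suc k) (column_label k i) = - F $$ (i, 0)"
     "core_entry B\<^sub>0 s y \<gamma> (False, Suc k) (column_label k i) = - F $$ (i, Suc 0)"
      unfolding sw n F0[OF i] F1[OF i] by simp_all
  qed
  have ysk: "s (Suc k) \<bullet> y (Suc k) = y (Suc k) \<bullet> s (Suc k)"
    by (intro comm_scalar_prod[of _ n]) (auto simp: s y)
  fix i j assume "i < dim_row (four_block_mat ?C (- F) (- F\<^sup>T) ?G)"
    "j < dim_col (four_block_mat ?C (- F) (- F\<^sup>T) ?G)"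
  then have i: "i < 2 * Suc (Suc k)" and j: "j < 2 * Suc (Suc k)" using dims by auto
  have "?L $$ (i, j) = core_entry B\<^sub>0 s y \<gamma> (column_label (Suc k) (Pi_index (Suc k) i))
      (column_label (Suc k) (Pi_index (Suc k) j))"
    unfolding Pi_mat_conjugate_index[OF core_mat_carrier i j]
    by (intro core_mat_index[OF B0] Pi_index_less i j s y)
  also have "\<dots> = four_block_mat ?C (- F) (- F\<^sup>T) ?G $$ (i, j)"
    using i j unfolding lt_2_Suc_Suc
    by (elim disjE)
      (simp_all add: dims column_label_Pi_index core_mat_index[OF B0] s y new pair_core_def
        mat_of_rows_list_def ysk del: mult_Suc_right)
  finally show "?L $$ (i, j) = four_block_mat ?C (- F) (- F\<^sup>T) ?G $$ (i, j)" .
qed (use core_mat_carrier[of n B\<^sub>0 s y \<gamma> k] Pi_mat_carrier[of "Suc k"]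
   in \<open>auto simp: pair_core_def mat_of_rows_list_def\<close>)

section \<open>The recursion for the closed form\<close>

lemma E_mat_eq: "E_mat B s y \<phi> j = step_selector (is_SR1 (B j) (s j) (y j) (\<phi> j))"
  by (simp add: E_mat_def step_selector_def)

lemma Xi_mat_carrier: "Xi_mat B s y \<phi> k \<in> carrier_mat (2 * Suc k) (dim_col (Xi_mat B s y \<phi> k))"
proof (cases k)
  case 0
  then show ?thesis using step_selector_carrier by (simp add: E_mat_eq)
next
  case (Suc l)
  then show ?thesis
    using carrier_matD[OF Pi_mat_carrier[of l]]
      carrier_matD(1)[OF step_selector_carrier[of "is_SR1 (B k) (s k) (y k) (\<phi> k)"]]
    by (auto simp: Let_def E_mat_eq)
qed

lemma Xi_mat_Suc:
  "Xi_mat B s y \<phi> (Suc k) = four_block_mat ((Pi_mat k)\<^sup>T * Xi_mat B s y \<phi> k)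
     (0\<^sub>m (2 * Suc k) (dim_col (E_mat B s y \<phi> (Suc k))))
     (0\<^sub>m 2 (dim_col (Xi_mat B s y \<phi> k))) (E_mat B s y \<phi> (Suc k))"
  using carrier_matD[OF Pi_mat_carrier[of k]] carrier_matD(1)[OF step_selector_carrier]
  by (simp add: Let_def E_mat_eq)

lemma M_hat_inv_eq:
  fixes B s y \<phi>
  defines "\<gamma> \<equiv> \<lambda>j. gamma_coeff (B j) (s j) (y j) (\<phi> j)"
  shows "M_hat_inv n B s y \<phi> k = (Xi_mat B s y \<phi> k)\<^sup>T *
    (Pi_mat k * core_mat n (B 0) s y \<gamma> k * (Pi_mat k)\<^sup>T) * Xi_mat B s y \<phi> k"
proof -
  have "M_hat_inv n B s y \<phi> k = (Xi_mat B s y \<phi> k)\<^sup>T * Pi_mat k * core_mat n (B 0) s y \<gamma> k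
      * (Pi_mat k)\<^sup>T * Xi_mat B s y \<phi> k"
    unfolding M_hat_inv_def core_mat_def Gamma_mat_def Let_def \<gamma>_def ..
  then show ?thesis
    by (simp add: mult_assoc_dim carrier_matD[OF Pi_mat_carrier[of k]]
        carrier_matD(1)[OF Xi_mat_carrier[of B s y \<phi> k]]
        carrier_matD[OF core_mat_carrier[of n "B 0" s y \<gamma> k]])
qed

lemma Psi_hat_Suc:
  assumes B0: "B 0 \<in> carrier_mat n n"
    and s: "\<And>j. j \<le> Suc k \<Longrightarrow> s j \<in> carrier_vec n" and y: "\<And>j. j \<le> Suc k \<Longrightarrow> y j \<in> carrier_vec n"
  shows "Psi_hat n B s y \<phi> (Suc k) = hcat (Psi_hat n B s y \<phi> k)
    (mat_of_cols n [B 0 *\<^sub>v s (Suc k), y (Suc k)] * E_mat B s y \<phi> (Suc k))"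
proof -
  note P = Psi_mat_carrier[OF B0, of s y k]
  let ?W = "mat_of_cols n [B 0 *\<^sub>v s (Suc k), y (Suc k)]"
  let ?Z = "(Pi_mat k)\<^sup>T * Xi_mat B s y \<phi> k" and ?E = "E_mat B s y \<phi> (Suc k)"
  define m r where "m = dim_col (Xi_mat B s y \<phi> k)" and "r = dim_col ?E"
  have X: "Xi_mat B s y \<phi> k \<in> carrier_mat (2 * Suc k) m" unfolding m_def by (rule Xi_mat_carrier)
  have Z: "?Z \<in> carrier_mat (2 * Suc k) m" using X Pi_mat_carrier[of k] by auto
  have E: "?E \<in> carrier_mat 2 r" unfolding r_def E_mat_eq by (rule step_selector_carrier)
  have W: "?W \<in> carrier_mat n 2" by (auto simp: numeral_2_eq_2)
  have "Psi_hat n B s y \<phi> (Suc k) = hcat (Psi_mat n (B 0) s y k) ?W *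
      four_block_mat ?Z (0\<^sub>m (2 * Suc k) r) (0\<^sub>m 2 m) ?E"
    unfolding Psi_hat_def Xi_mat_Suc m_def r_def using Psi_mat_Suc_Pi[OF B0 s y] by simp
  also have "\<dots> = hcat (Psi_mat n (B 0) s y k * ?Z + ?W * 0\<^sub>m 2 m) (Psi_mat n (B 0) s y k * 0\<^sub>m (2 * Suc k) r + ?W * ?E)"
    by (rule hcat_mult_four_block[OF P W Z _ _ E]) auto
  also have "Psi_mat n (B 0) s y k * ?Z + ?W * 0\<^sub>m 2 m = Psi_mat n (B 0) s y k * ?Z"
    unfolding right_mult_zero_mat[OF W] using mult_carrier_mat[OF P Z] by (rule right_add_zero_mat)
  also have "Psi_mat n (B 0) s y k * 0\<^sub>m (2 * Suc k) r + ?W * ?E = ?W * ?E"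
    unfolding right_mult_zero_mat[OF P] using mult_carrier_mat[OF W E] by (rule left_add_zero_mat)
  also have "Psi_mat n (B 0) s y k * ?Z = Psi_hat n B s y \<phi> k"
    unfolding Psi_hat_def using P Pi_mat_carrier[of k] X
    by (intro assoc_mult_mat[symmetric]) auto
  finally show ?thesis .
qed

text \<open>\<open>\<Xi>\<close> is block diagonal in the reordered columns, so it acts separately on the older pairs, where it reproduces the
previous matrix, and on the newest one.\<close>

lemma M_hat_inv_Suc:
  fixes \<phi> :: "nat \<Rightarrow> real"
  assumes B0: "B 0 \<in> carrier_mat n n" and sym: "(B 0)\<^sup>T = B 0"
    and s: "\<And>j. j \<le> Suc k \<Longrightarrow> s j \<in> carrier_vec n" and y: "\<And>j. j \<le> Suc k \<Longrightarrow> y j \<in> carrier_vec n"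
  defines "E \<equiv> E_mat B s y \<phi> (Suc k)"
    and "F \<equiv> (Psi_hat n B s y \<phi> k)\<^sup>T * mat_of_cols n [s (Suc k), 0\<^sub>v n] * E_mat B s y \<phi> (Suc k)"
  shows "M_hat_inv n B s y \<phi> (Suc k) = four_block_mat (M_hat_inv n B s y \<phi> k) (- F) (- F\<^sup>T)
    (E\<^sup>T * pair_core (s (Suc k) \<bullet> (B 0 *\<^sub>v s (Suc k))) (y (Suc k) \<bullet> s (Suc k))
      (gamma_coeff (B (Suc k)) (s (Suc k)) (y (Suc k)) (\<phi> (Suc k))) * E)"
proof -
  define \<gamma> where "\<gamma> = (\<lambda>j. gamma_coeff (B j) (s j) (y j) (\<phi> j))"
  let ?P = "Psi_mat n (B 0) s y k" and ?S = "mat_of_cols n [s (Suc k), 0\<^sub>v n]"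
  let ?C = "core_mat n (B 0) s y \<gamma> k"
  let ?G = "pair_core (s (Suc k) \<bullet> (B 0 *\<^sub>v s (Suc k))) (y (Suc k) \<bullet> s (Suc k)) (\<gamma> (Suc k))"
  let ?X = "Xi_mat B s y \<phi> k"
  define Z where "Z = (Pi_mat k)\<^sup>T * ?X"
  define H where "H = ?P\<^sup>T * ?S"
  define m r where "m = dim_col ?X" and "r = dim_col E"
  note P = Psi_mat_carrier[OF B0, of s y k]
  note C = core_mat_carrier[of n "B 0" s y \<gamma> k]
  have X: "?X \<in> carrier_mat (2 * Suc k) m" unfolding m_def by (rule Xi_mat_carrier)
  have Z: "Z \<in> carrier_mat (2 * Suc k) m" unfolding Z_def using X Pi_mat_carrier[of k] by auto
  have E: "E \<in> carrier_mat 2 r" unfolding r_def E_def E_mat_eq by (rule step_selector_carrier)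
  have S: "?S \<in> carrier_mat n 2" by (auto simp: numeral_2_eq_2)
  have H: "H \<in> carrier_mat (2 * Suc k) 2" unfolding H_def using P S by auto
  have G: "?G \<in> carrier_mat 2 2" by (auto simp: pair_core_def mat_of_rows_list_def)
  note dims = carrier_matD[OF P] carrier_matD[OF C] carrier_matD[OF X] carrier_matD[OF Z]
    carrier_matD[OF E] carrier_matD[OF S] carrier_matD[OF H] carrier_matD[OF G]
    carrier_matD[OF Pi_mat_carrier[of k]]
  have Zt: "Z\<^sup>T \<in> carrier_mat m (2 * Suc k)" and Et: "E\<^sup>T \<in> carrier_mat r 2" and Ht: "H\<^sup>T \<in> carrier_mat 2 (2 * Suc k)"
    using Z E H by auto
  have Xi: "Xi_mat B s y \<phi> (Suc k) = four_block_mat Z (0\<^sub>m (2 * Suc k) r) (0\<^sub>m 2 m) E"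
    unfolding Xi_mat_Suc Z_def E_def m_def r_def ..
  have Xit: "(Xi_mat B s y \<phi> (Suc k))\<^sup>T = four_block_mat Z\<^sup>T (0\<^sub>m m 2) (0\<^sub>m r (2 * Suc k)) E\<^sup>T"
    unfolding Xi using Z E by (subst transpose_four_block_mat) (auto simp del: mult_Suc_right)
  have ZHE: "Z\<^sup>T * H * E = F"
    unfolding F_def E_def[symmetric] Z_def H_def Psi_hat_def
    by (simp add: transpose_mult_dim mult_assoc_dim dims del: mult_Suc_right)
  have "M_hat_inv n B s y \<phi> (Suc k) = (Xi_mat B s y \<phi> (Suc k))\<^sup>T *
      four_block_mat ?C (- H) (- H\<^sup>T) ?G * Xi_mat B s y \<phi> (Suc k)"
    unfolding M_hat_inv_eq H_def \<gamma>_def using core_mat_Suc_Pi[OF B0 sym s y] by simp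
  also have "(Xi_mat B s y \<phi> (Suc k))\<^sup>T * four_block_mat ?C (- H) (- H\<^sup>T) ?G
      = four_block_mat (Z\<^sup>T * ?C) (- (Z\<^sup>T * H)) (- (E\<^sup>T * H\<^sup>T)) (E\<^sup>T * ?G)"
    unfolding Xit using Zt Et H Ht G C
    by (subst mult_four_block_mat[of _ m "2 * Suc k" _ 2 _ r])
      (auto simp: dims simp del: mult_Suc_right)
  also have "\<dots> * Xi_mat B s y \<phi> (Suc k)
      = four_block_mat (Z\<^sup>T * ?C * Z) (- (Z\<^sup>T * H * E)) (- (E\<^sup>T * H\<^sup>T * Z)) (E\<^sup>T * ?G * E)"
    unfolding Xi using Zt Et Z E H Ht G C
    by (subst mult_four_block_mat[of _ m "2 * Suc k" _ 2 _ r])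
      (auto simp: dims simp del: mult_Suc_right)
  also have "Z\<^sup>T * ?C * Z = M_hat_inv n B s y \<phi> k"
    unfolding M_hat_inv_eq Z_def \<gamma>_def[symmetric]
    by (simp add: transpose_mult_dim mult_assoc_dim dims del: mult_Suc_right)
  also note ZHE
  also have "E\<^sup>T * H\<^sup>T * Z = (Z\<^sup>T * H * E)\<^sup>T"
    by (simp add: transpose_mult_dim mult_assoc_dim dims del: mult_Suc_right)
  also note ZHE
  finally show ?thesis unfolding \<gamma>_def .
qed

text \<open>The recursions of the two closed forms match, block by block, the representation that
\<open>compact_rep_broyden_step\<close> builds from the previous one.\<close>

lemma compact_rep_broyden_sequence:
  assumes B0: "B 0 \<in> carrier_mat n n" and sym: "(B 0)\<^sup>T = B 0"
    and s: "\<And>j. j \<le> k \<Longrightarrow> s j \<in> carrier_vec n" and y: "\<And>j. j \<le> k \<Longrightarrow> y j \<in> carrier_vec n"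
    and update: "\<And>j. j \<le> k \<Longrightarrow> B (Suc j) = broyden_update (B j) (s j) (y j) (\<phi> j)"
    and ys: "\<And>j. j \<le> k \<Longrightarrow> y j \<bullet> s j \<noteq> 0"
    and sBs: "\<And>j. j \<le> k \<Longrightarrow> s j \<bullet> (B j *\<^sub>v s j) \<noteq> 0"
  shows "compact_rep n (dim_col (Xi_mat B s y \<phi> k)) (B 0) (Psi_hat n B s y \<phi> k)
    (M_hat_inv n B s y \<phi> k) (B (Suc k))"
  using s y update ys sBs
proof (induction k)
  case 0
  let ?E = "step_selector (is_SR1 (B 0) (s 0) (y 0) (\<phi> 0))"
  define \<gamma> where "\<gamma> = (\<lambda>j. gamma_coeff (B j) (s j) (y j) (\<phi> j))"
  have s0: "s 0 \<in> carrier_vec n" and y0: "y 0 \<in> carrier_vec n" using 0 by auto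
  have W: "Psi_mat n (B 0) s y 0 * (Pi_mat 0)\<^sup>T = mat_of_cols n [B 0 *\<^sub>v s 0, y 0]"
  proof -
    have "Psi_mat n (B 0) s y 0 $$ (i, j) = Psi_column (B 0) s y (column_label 0 j) $ i"
      if "i < n" "j < 2" for i j
      using that s0 y0 by (intro Psi_mat_index[OF B0]) auto
    then have "Psi_mat n (B 0) s y 0 = mat_of_cols n [B 0 *\<^sub>v s 0, y 0]"
      using B0 s0 y0 Psi_mat_carrier[OF B0, of s y 0]
      by (intro eq_matI) (auto simp: column_label_def mat_of_cols_index less_Suc_eq
        simp del: index_mult_mat_vec)
    moreover have "mat_of_cols n [B 0 *\<^sub>v s 0, y 0] \<in> carrier_mat n 2" by (auto simp: numeral_2_eq_2)
    ultimately show ?thesis by (simp add: Pi_mat_def transpose_one)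
  qed
  have ys0: "s 0 \<bullet> y 0 = y 0 \<bullet> s 0" using s0 y0 by (intro comm_scalar_prod) auto
  have core: "core_mat n (B 0) s y \<gamma> 0 $$ (i, j)
      = core_entry (B 0) s y \<gamma> (column_label 0 i) (column_label 0 j)" if "i < 2" "j < 2" for i j
    using that s0 y0 by (intro core_mat_index[OF B0]) auto
  have C: "core_mat n (B 0) s y \<gamma> 0 = pair_core (s 0 \<bullet> (B 0 *\<^sub>v s 0)) (y 0 \<bullet> s 0) (\<gamma> 0)" (is "_ = ?G")
    using core_mat_carrier[of n "B 0" s y \<gamma> 0] s0 y0 ys0
    by (intro eq_matI) (auto simp: core column_label_def pair_core_def
       mat_of_rows_list_def numeral_2_eq_2 less_Suc_eq simp del: index_mult_mat_vec)
  have "Pi_mat 0 * core_mat n (B 0) s y \<gamma> 0 * (Pi_mat 0)\<^sup>T = ?G"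
    unfolding C by (simp add: Pi_mat_def transpose_one pair_core_def mat_of_rows_list_def)
  then have "M_hat_inv n B s y \<phi> 0 = ?E\<^sup>T * ?G * ?E"
    unfolding M_hat_inv_eq \<gamma>_def by (simp add: E_mat_eq)
  moreover have "Psi_hat n B s y \<phi> 0 = mat_of_cols n [B 0 *\<^sub>v s 0, y 0] * ?E"
    unfolding Psi_hat_def W by (simp add: E_mat_eq)
  ultimately show ?case
    using compact_rep_single_update[OF B0 sym s0 y0, of "\<phi> 0"] 0
    by (simp add: \<gamma>_def E_mat_eq)
next
  case (Suc k)
  have IH: "compact_rep n (dim_col (Xi_mat B s y \<phi> k)) (B 0) (Psi_hat n B s y \<phi> k)
    (M_hat_inv n B s y \<phi> k) (B (Suc k))"
    using Suc by simp
  have dim: "dim_col (Xi_mat B s y \<phi> (Suc k))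
      = dim_col (Xi_mat B s y \<phi> k) + dim_col (E_mat B s y \<phi> (Suc k))"
    unfolding Xi_mat_Suc by simp
  have "compact_rep n (dim_col (Xi_mat B s y \<phi> (Suc k))) (B 0) (Psi_hat n B s y \<phi> (Suc k))
    (M_hat_inv n B s y \<phi> (Suc k))
    (broyden_update (B (Suc k)) (s (Suc k)) (y (Suc k)) (\<phi> (Suc k)))"
    using compact_rep_broyden_step[OF IH sym, of "s (Suc k)" "y (Suc k)" "\<phi> (Suc k)"] Suc.prems(4,5)
    by (simp only: dim Psi_hat_Suc[of B, OF B0] M_hat_inv_Suc[of B, OF B0 sym] Suc.prems(1,2) E_mat_eq
        order.refl simp_thms)
  then show ?case using Suc.prems(3) by simp
qed

text \<open>A matrix has only one inverse, so the middle matrix found by induction is the one that Gauss-Jordan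
elimination returns.\<close>

theorem theorem1:
  fixes n k :: nat
    and B :: "nat \<Rightarrow> real mat"
    and s y :: "nat \<Rightarrow> real vec"
    and \<phi> :: "nat \<Rightarrow> real"
  assumes B0_carrier: "B 0 \<in> carrier_mat n n"
    and B0_symmetric: "(B 0)\<^sup>T = B 0"
    and s_carrier: "\<And>j. j \<le> k \<Longrightarrow> s j \<in> carrier_vec n"
    and y_carrier: "\<And>j. j \<le> k \<Longrightarrow> y j \<in> carrier_vec n"
    and update: "\<And>j. j \<le> k \<Longrightarrow> B (Suc j) = broyden_update (B j) (s j) (y j) (\<phi> j)"
    and ys_nonzero: "\<And>j. j \<le> k \<Longrightarrow> y j \<bullet> s j \<noteq> 0"
    and sBs_nonzero: "\<And>j. j \<le> k \<Longrightarrow> s j \<bullet> (B j *\<^sub>v s j) \<noteq> 0"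
    and nonsingular: "\<And>j. j \<le> Suc k \<Longrightarrow> invertible_mat (B j)"
  shows "invertible_mat (M_hat_inv n B s y \<phi> k)
    \<and> B (Suc k) = B 0 + Psi_hat n B s y \<phi> k * M_hat n B s y \<phi> k * (Psi_hat n B s y \<phi> k)\<^sup>T"
proof -
  define m where "m = dim_col (Xi_mat B s y \<phi> k)"
  let ?N = "M_hat_inv n B s y \<phi> k" and ?P = "Psi_hat n B s y \<phi> k"
  have "compact_rep n m (B 0) ?P ?N (B (Suc k))"
    unfolding m_def
    by (rule compact_rep_broyden_sequence)
      (use B0_carrier B0_symmetric s_carrier y_carrier update ys_nonzero sBs_nonzero in auto)
  then obtain M where N: "?N \<in> carrier_mat m m" and M: "M \<in> carrier_mat m m"
    and MN: "M * ?N = 1\<^sub>m m" and NM: "?N * M = 1\<^sub>m m"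
    and eq: "B (Suc k) = B 0 + ?P * M * ?P\<^sup>T"
    unfolding compact_rep_def by auto
  have inv: "invertible_mat ?N"
    using N M MN NM unfolding invertible_mat_def inverts_mat_def by auto
  have "?N \<in> Units (ring_mat TYPE(real) m ())"
    using N M MN NM unfolding Units_def by (auto simp: ring_mat_simps)
  then obtain M' where M'_def: "mat_inverse ?N = Some M'"
    using mat_inverse(1)[OF N, where b = "()"] by (cases "mat_inverse ?N") auto
  then have M': "M' * ?N = 1\<^sub>m m" "M' \<in> carrier_mat m m"
    using mat_inverse(2)[OF N] by auto
  have "M' = M' * (?N * M)" using NM M' by simp
  also have "\<dots> = M" using M' M N by (simp flip: assoc_mult_mat[of _ m m _ m])
  finally have "M_hat n B s y \<phi> k = M" unfolding M_hat_def M'_def by simp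
  then show ?thesis using inv eq by simp
qed

end
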